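(* There exist $R \in \mathbb{N}$ and a constant $c_R > 0$ such that for all sufficiently large $n \in \mathbb{N}$, \[ f_R(n) \ge \exp\left( \frac{c_R \log n}{\log \log n} \right). \]
   Context: The $n \times n$ grid is the graph whose vertices are the $n^2$ squares of an $n\times n$ board, two squares being adjacent if and only if they share an edge. The game of cops and robbers with a robber of speed $R \in \mathbb{N}$ is played on this graph as follows. First, a set of cops are placed on vertices of their choice (several cops may occupy the same vertex); then the robber, knowing the cops' positions, chooses a vertex. Thereafter the players alternate turns, the cops moving first: on the cops' turn, each cop either moves to an adjacent vertex or stays put; on the robber's turn, the robber may move along any walk of length at most $R$ starting at his current position that does not pass through a vertex occupied by a cop (in particular he may stay put). The cops win if at some time some cop occupies the same vertex as the robber; otherwise the robber wins. $f_R(n)$ denotes the minimum number of cops for which the cops have a winning strategy on the $n\times n$ grid against a robber of speed $R$, no matter how the robber plays. *)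

theory Defs
  imports Complex_Main "Graph_Theory.Pair_Digraph" "Graph_Theory.Vertex_Walk"
begin

text \<open>An undirected graph is a symmetric digraph, each edge giving two opposite arcs.\<close>

definition grid :: "nat \<Rightarrow> (nat \<times> nat) pair_pre_digraph" where
  "grid n = \<lparr> pverts = {..<n} \<times> {..<n},
     parcs = {((i, j), (i', j')).
       i < n \<and> j < n \<and> i' < n \<and> j' < n \<and>
       (i = i' \<and> (j' = Suc j \<or> j = Suc j') \<or> j = j' \<and> (i' = Suc i \<or> i = Suc i'))} \<rparr>"

lemma pair_graph_grid: "pair_graph (grid n)"
proof
  show "finite (pverts (grid n))" by (simp add: grid_def)
  have "parcs (grid n) \<subseteq> ({..<n} \<times> {..<n}) \<times> ({..<n} \<times> {..<n})"
    by (auto simp: grid_def)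
  then show "finite (parcs (grid n))"
    by (rule finite_subset) simp
  show "symmetric (with_proj (grid n))"
    by (auto simp: symmetric_def sym_def grid_def)
qed (auto simp: grid_def)

text \<open>A position of \<open>k\<close> cops is a list of length \<open>k\<close> whose \<open>i\<close>-th entry is the vertex of the
  \<open>i\<close>-th cop, so cops may share a vertex.\<close>

definition cops_move :: "('a, 'b) pre_digraph \<Rightarrow> 'a list \<Rightarrow> 'a list \<Rightarrow> bool" where
  "cops_move G cs cs' \<longleftrightarrow> list_all2 (\<lambda>u v. v = u \<or> u \<rightarrow>\<^bsub>G\<^esub> v) cs cs'"

definition robber_move :: "('a, 'b) pre_digraph \<Rightarrow> nat \<Rightarrow> 'a list \<Rightarrow> 'a \<Rightarrow> 'a \<Rightarrow> bool" where
  "robber_move G R cs u v \<longleftrightarrow>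
     (\<exists>p. vwalk p G \<and> hd p = u \<and> last p = v \<and> vwalk_length p \<le> R \<and> set p \<inter> set cs = {})"

text \<open>A strategy of the cops maps the list of vertices taken so far by the robber, oldest first, to
  the next position of the cops; in particular \<open>\<sigma> []\<close> is their initial placement. The cops' own
  earlier positions need not be given to \<open>\<sigma>\<close>, as it determines them. Requiring legal moves also
  after histories that never arise is no restriction, since the cops can stay put there.\<close>

definition cop_strategy ::
    "('a, 'b) pre_digraph \<Rightarrow> nat \<Rightarrow> ('a list \<Rightarrow> 'a list) \<Rightarrow> bool" where
  "cop_strategy G k \<sigma> \<longleftrightarrow>
     length (\<sigma> []) = k \<and> set (\<sigma> []) \<subseteq> verts G \<and> (\<forall>h v. cops_move G (\<sigma> h) (\<sigma> (h @ [v])))"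

text \<open>If \<open>r t\<close> is the vertex of the robber after his \<open>t\<close>-th move, then \<open>cops_at \<sigma> r t\<close> is the position
  of the cops after their \<open>t\<close>-th move, where move 0 is the initial placement. The order of events is
  \<open>cops_at \<sigma> r 0\<close>, \<open>r 0\<close>, \<open>cops_at \<sigma> r 1\<close>, \<open>r 1\<close>, and so on.\<close>

definition cops_at :: "('a list \<Rightarrow> 'a list) \<Rightarrow> (nat \<Rightarrow> 'a) \<Rightarrow> nat \<Rightarrow> 'a list" where
  "cops_at \<sigma> r t = \<sigma> (map r [0..<t])"

text \<open>The robber at \<open>r t\<close> meets a cop upon arrival or upon the next move of the cops.\<close>

definition caught :: "('a list \<Rightarrow> 'a list) \<Rightarrow> (nat \<Rightarrow> 'a) \<Rightarrow> nat \<Rightarrow> bool" where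
  "caught \<sigma> r t \<longleftrightarrow> r t \<in> set (cops_at \<sigma> r t) \<or> r t \<in> set (cops_at \<sigma> r (Suc t))"

text \<open>The game ends with a capture, so the rules bind the robber only until then.\<close>

definition robber_play ::
    "('a, 'b) pre_digraph \<Rightarrow> nat \<Rightarrow> ('a list \<Rightarrow> 'a list) \<Rightarrow> (nat \<Rightarrow> 'a) \<Rightarrow> bool" where
  "robber_play G R \<sigma> r \<longleftrightarrow>
     r 0 \<in> verts G \<and>
     (\<forall>t. (\<forall>s\<le>t. \<not> caught \<sigma> r s) \<longrightarrow>
        robber_move G R (cops_at \<sigma> r (Suc t)) (r t) (r (Suc t)))"

definition cops_win :: "('a, 'b) pre_digraph \<Rightarrow> nat \<Rightarrow> nat \<Rightarrow> bool" where
  "cops_win G R k \<longleftrightarrow>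
     (\<exists>\<sigma>. cop_strategy G k \<sigma> \<and> (\<forall>r. robber_play G R \<sigma> r \<longrightarrow> (\<exists>t. caught \<sigma> r t)))"

definition cop_number :: "nat \<Rightarrow> ('a, 'b) pre_digraph \<Rightarrow> nat" where
  "cop_number R G = (LEAST k. cops_win G R k)"

text \<open>The minimum exists on a finite graph: a cop on every vertex wins at once.\<close>

lemma cops_win_card_verts:
  assumes "finite (verts G)"
  shows "cops_win G R (card (verts G))"
proof -
  obtain cs where cs: "set cs = verts G" "distinct cs"
    using finite_distinct_list[OF assms] by blast
  have "cop_strategy G (card (verts G)) (\<lambda>_. cs)"
    using cs by (auto simp: cop_strategy_def cops_move_def distinct_card[symmetric]
        intro: list.rel_refl)
  moreover have "caught (\<lambda>_. cs) r 0" if "robber_play G R (\<lambda>_. cs) r" for r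
    using that cs by (auto simp: caught_def cops_at_def robber_play_def)
  ultimately show ?thesis
    unfolding cops_win_def by blast
qed

end

theory Submission
  imports Defs "HOL-Library.Disjoint_Sets" "HOL-Real_Asymp.Real_Asymp"
begin

text \<open>
  The robber's strategy is recursive in scale. Suppose that he can run a distance \<open>N\<close> in about
  \<open>T\<close> turns, \<open>T\<close> a tiny fraction of \<open>N\<close>, through any corridor containing at most \<open>\<kappa>\<close> cops.
  To run a distance \<open>L N\<close> through a corridor with \<open>2 \<kappa>\<close> cops he moves along a lattice of spacing
  \<open>N\<close>, always staying at lattice points with at most \<open>\<kappa> / 2\<close> cops nearby. If the next lattice
  point is too crowded, he chooses one of four detours that are disjoint away from his present
  position: one of them holds at most \<open>\<kappa> / 2\<close> further cops. The more than \<open>\<kappa> / 2\<close> cops that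
  forced the detour are left behind and are too slow to catch up, so there are at most four such
  detours, and the run takes at most \<open>(L + 2000) T\<close> turns. With \<open>m\<close> scales and \<open>L = 2000 m\<close> the
  accumulated loss of speed is a constant factor: \<open>2\<^sup>m / 2\<close> cops do not suffice on a board of side
  \<open>O(m)\<^sup>m\<close>.
\<close>

section \<open>Runs through corridors\<close>

definition near :: "int \<Rightarrow> int \<times> int \<Rightarrow> int \<times> int \<Rightarrow> bool" where
  "near r p q \<longleftrightarrow> \<bar>fst q - fst p\<bar> \<le> r \<and> \<bar>snd q - snd p\<bar> \<le> r"

definition box :: "int \<times> int \<Rightarrow> int \<times> int \<Rightarrow> int \<Rightarrow> (int \<times> int) set" where
  "box p q w = {min (fst p) (fst q) - w .. max (fst p) (fst q) + w} \<times>
     {min (snd p) (snd q) - w .. max (snd p) (snd q) + w}"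

definition dirs :: "(int \<times> int) set" where
  "dirs = {(1, 0), (-1, 0), (0, 1), (0, -1)}"

text \<open>
  The robber's ability to run a distance \<open>N\<close> within \<open>T\<close> turns, hitting the target up to an error
  \<open>e\<close>, whenever the corridor (with a margin \<open>w\<close>, inside the board \<open>V\<close>) contains at most \<open>\<kappa>\<close> of
  the \<open>k\<close> cops. A state is a position with the robber to move, and a \<open>step\<close> consists of his move
  and the reply of the cops; \<open>P\<close> collects what must hold at the smaller scales before and after a
  run.
\<close>

definition mover ::
    "('s \<Rightarrow> 's \<Rightarrow> bool) \<Rightarrow> nat \<Rightarrow> ('s \<Rightarrow> int \<times> int) \<Rightarrow> ('s \<Rightarrow> nat \<Rightarrow> int \<times> int) \<Rightarrow> (int \<times> int) set \<Rightarrow>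
     ('s \<Rightarrow> bool) \<Rightarrow> int \<Rightarrow> nat \<Rightarrow> int \<Rightarrow> int \<Rightarrow> real \<Rightarrow> bool" where
  "mover step k rob cop V P N T e w \<kappa> \<longleftrightarrow>
     (\<forall>s d q. P s \<longrightarrow> d \<in> dirs \<longrightarrow>
        near e (fst (rob s) + N * fst d, snd (rob s) + N * snd d) q \<longrightarrow>
        box (rob s) q w \<subseteq> V \<longrightarrow>
        real (card {i. i < k \<and> cop s i \<in> box (rob s) q w}) \<le> \<kappa> \<longrightarrow>
        (\<exists>s' t. t \<le> T \<and> (step ^^ t) s s' \<and> P s' \<and> near e q (rob s')))"

definition light ::
    "nat \<Rightarrow> ('s \<Rightarrow> int \<times> int) \<Rightarrow> ('s \<Rightarrow> nat \<Rightarrow> int \<times> int) \<Rightarrow> int \<Rightarrow> real \<Rightarrow> 's \<Rightarrow> bool" where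
  "light k rob cop N a s \<longleftrightarrow> real (card {i. i < k \<and> near (5 * N) (rob s) (cop s i)}) \<le> a"

definition reach :: "('s \<Rightarrow> 's \<Rightarrow> bool) \<Rightarrow> 's \<Rightarrow> nat \<Rightarrow> 's \<Rightarrow> bool" where
  "reach step s t s' \<longleftrightarrow> (\<exists>t'\<le>t. (step ^^ t') s s')"

section \<open>Distances in the maximum norm and runs of bounded duration\<close>

lemma box_bounds:
  assumes "x \<in> box p q w"
  shows "a \<le> fst p \<Longrightarrow> a \<le> fst q \<Longrightarrow> a - w \<le> fst x" "fst p \<le> b \<Longrightarrow> fst q \<le> b \<Longrightarrow> fst x \<le> b + w"
    "c \<le> snd p \<Longrightarrow> c \<le> snd q \<Longrightarrow> c - w \<le> snd x" "snd p \<le> d \<Longrightarrow> snd q \<le> d \<Longrightarrow> snd x \<le> d + w"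
  using assms unfolding box_def by auto

lemma near_sym: "near r p q \<longleftrightarrow> near r q p"
  by (auto simp: near_def abs_minus_commute)

lemma near_trans: "near r p q \<Longrightarrow> near r' q x \<Longrightarrow> near (r + r') p x"
  by (auto simp: near_def)

lemma near_mono: "near r p q \<Longrightarrow> r \<le> r' \<Longrightarrow> near r' p q"
  by (auto simp: near_def)

lemma reach_refl: "reach step s t s"
  unfolding reach_def by (intro exI[of _ 0]) auto

lemma reach_trans:
  assumes "reach step s t s'" "reach step s' t' s''" shows "reach step s (t + t') s''"
proof -
  obtain u v where "u \<le> t" "(step ^^ u) s s'" "v \<le> t'" "(step ^^ v) s' s''"
    using assms by (auto simp: reach_def)
  then have "u + v \<le> t + t'" "(step ^^ (u + v)) s s''"
    by (auto simp: relpowp_add)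
  then show ?thesis unfolding reach_def by blast
qed

lemma reach_mono: "reach step s t s' \<Longrightarrow> t \<le> t' \<Longrightarrow> reach step s t' s'"
  unfolding reach_def using le_trans by blast

lemma relpowp_near:
  assumes slow: "\<And>s s'. step s s' \<Longrightarrow> near 1 (c s) (c s')" and "(step ^^ t) s s'"
  shows "near (int t) (c s) (c s')"
  using assms(2)
proof (induction t arbitrary: s')
  case 0 then show ?case by (auto simp: near_def)
next
  case (Suc t)
  then obtain s1 where "(step ^^ t) s s1" "step s1 s'" by auto
  from near_trans[OF Suc.IH[OF this(1)] slow[OF this(2)]] show ?case by (simp add: add.commute)
qed

lemma reach_near:
  assumes slow: "\<And>s s'. step s s' \<Longrightarrow> near 1 (c s) (c s')" and "reach step s t s'"
  shows "near (int t) (c s) (c s')"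
proof -
  obtain u where u: "u \<le> t" "(step ^^ u) s s'" using assms(2) by (auto simp: reach_def)
  have "near (int u) (c s) (c s')" by (rule relpowp_near[OF slow u(2)])
  then show ?thesis using u(1) by (auto elim: near_mono)
qed

lemma mover_reach:
  assumes "mover step k rob cop V P N T e w \<kappa>" "P s" "d \<in> dirs"
    "near e (fst (rob s) + N * fst d, snd (rob s) + N * snd d) q" "box (rob s) q w \<subseteq> V"
    "real (card {i. i < k \<and> cop s i \<in> box (rob s) q w}) \<le> \<kappa>"
  shows "\<exists>s'. reach step s T s' \<and> P s' \<and> near e q (rob s')"
  using assms unfolding mover_def reach_def by blast

section \<open>Coarse motion on the lattice of spacing \<open>N\<close>\<close>

text \<open>One scale with its slack. No detour takes more than \<open>300 * T\<close> turns, in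
  which a cop moves at most \<open>N / 8\<close>; \<open>e\<close> and \<open>w\<close> are at most
  \<open>N / 8\<close> as well. The three together stay below \<open>N / 2\<close>, half a cell, so
  rounding to cells absorbs them.\<close>

locale level =
  fixes step :: "'s \<Rightarrow> 's \<Rightarrow> bool" and k :: nat and rob :: "'s \<Rightarrow> int \<times> int"
    and cop :: "'s \<Rightarrow> nat \<Rightarrow> int \<times> int" and V :: "(int \<times> int) set" and P :: "'s \<Rightarrow> bool"
    and N :: int and T :: nat and e w :: int and \<kappa> :: real
  assumes slow: "\<And>s s' i. step s s' \<Longrightarrow> near 1 (cop s i) (cop s' i)"
    and mover: "mover step k rob cop V P N T e w \<kappa>"
    and N_pos: "0 < N" and w_bounds: "0 \<le> w" "8 * w \<le> N" and e_bounds: "0 \<le> e" "8 * e \<le> N"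
    and T_bound: "2400 * int T \<le> N" and \<kappa>_pos: "0 < \<kappa>"
begin

text \<open>The quotient \<open>x / N\<close> rounded to the nearest integer, halves
  upwards.\<close>

definition cell1 :: "int \<Rightarrow> int" where
  "cell1 x = (2 * x + N) div (2 * N)"

definition cell :: "int \<times> int \<Rightarrow> int \<times> int" where
  "cell p = (cell1 (fst p), cell1 (snd p))"

definition cnt :: "'s \<Rightarrow> (int \<times> int) set \<Rightarrow> nat" where
  "cnt s S = card {i. i < k \<and> cell (cop s i) \<in> S}"

definition at_cell :: "'s \<Rightarrow> int \<times> int \<Rightarrow> bool" where
  "at_cell s v \<longleftrightarrow> near e (N * fst v, N * snd v) (rob s)"

definition inside :: "(int \<times> int) set \<Rightarrow> bool" where
  "inside S \<longleftrightarrow> (\<forall>v\<in>S. \<forall>x. near N (N * fst v, N * snd v) x \<longrightarrow> x \<in> V)"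

abbreviation square :: "int \<times> int \<Rightarrow> int \<Rightarrow> (int \<times> int) set" where
  "square v r \<equiv> {u. near r v u}"

lemma cell1_lower: "2 * (N * cell1 x) - N \<le> 2 * x"
  and cell1_upper: "2 * x < 2 * (N * cell1 x) + N"
proof -
  have "2 * x + N = 2 * N * cell1 x + (2 * x + N) mod (2 * N)"
    unfolding cell1_def by simp
  moreover have "0 \<le> (2 * x + N) mod (2 * N)" "(2 * x + N) mod (2 * N) < 2 * N"
    using N_pos by simp_all
  ultimately show "2 * (N * cell1 x) - N \<le> 2 * x" "2 * x < 2 * (N * cell1 x) + N"
    unfolding mult.assoc by linarith+
qed

lemma cell1_ge: "X \<le> cell1 x" if "2 * (N * X) - N \<le> 2 * x"
proof (rule ccontr)
  assume "\<not> X \<le> cell1 x"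
  then have "N * (cell1 x + 1) \<le> N * X" using N_pos by (intro mult_left_mono) auto
  then show False using that cell1_upper[of x] by (simp add: distrib_left)
qed

lemma cell1_le: "cell1 x \<le> X" if "2 * x < 2 * (N * X) + N"
proof (rule ccontr)
  assume "\<not> cell1 x \<le> X"
  then have "N * (X + 1) \<le> N * cell1 x" using N_pos by (intro mult_left_mono) auto
  then show False using that cell1_lower[of x] by (simp add: distrib_left)
qed

lemma reach_cop: "reach step s t s' \<Longrightarrow> near (int t) (cop s i) (cop s' i)"
  by (rule reach_near[where c = "\<lambda>s. cop s i"]) (auto intro: slow)

lemma cnt_mono: "S \<subseteq> S' \<Longrightarrow> cnt s S \<le> cnt s S'"
  unfolding cnt_def by (rule card_mono) auto

lemma cnt_Un: "cnt s (S \<union> S') \<le> cnt s S + cnt s S'"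
proof -
  have "{i. i < k \<and> cell (cop s i) \<in> S \<union> S'} =
      {i. i < k \<and> cell (cop s i) \<in> S} \<union> {i. i < k \<and> cell (cop s i) \<in> S'}" by auto
  then show ?thesis unfolding cnt_def by (simp add: card_Un_le)
qed

lemma near_cell: "near N (N * fst (cell x), N * snd (cell x)) x"
  using cell1_lower[of "fst x"] cell1_upper[of "fst x"] cell1_lower[of "snd x"] cell1_upper[of "snd x"] N_pos
  unfolding near_def cell_def fst_conv snd_conv abs_le_iff by linarith

lemma inside_cell: "inside S \<Longrightarrow> cell x \<in> S \<Longrightarrow> x \<in> V"
  unfolding inside_def using near_cell by blast

text \<open>The errors \<open>e\<close>, \<open>w\<close> and \<tau> add up to at most
  \<open>3 * N / 8\<close>, less than half a cell. With \<tau> zero this keeps the corridor of a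
  lattice step on the board; with \<tau> the drift of a cop it locates the earlier position of a cop
  that is now in the corridor.\<close>

lemma cell_box_edge:
  assumes v: "at_cell s v" and d: "d \<in> dirs" and v': "v' = (fst v + fst d, snd v + snd d)"
    and y: "y \<in> box (rob s) (N * fst v', N * snd v') w" and xy: "near \<tau> x y" "8 * \<tau> \<le> N"
  shows "cell x = v \<or> cell x = v'"
proof -
  have rob: "N * fst v - e \<le> fst (rob s)" "fst (rob s) \<le> N * fst v + e"
    "N * snd v - e \<le> snd (rob s)" "snd (rob s) \<le> N * snd v + e"
    using v by (auto simp: at_cell_def near_def)
  have xy': "fst y - \<tau> \<le> fst x" "fst x \<le> fst y + \<tau>" "snd y - \<tau> \<le> snd x" "snd x \<le> snd y + \<tau>"
    using xy(1) by (auto simp: near_def)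
  \<comment> \<open>The ranges of the two coordinates over the edge; as \<open>d\<close> is a unit
    vector, the rectangle they span consists of \<open>v\<close> and \<open>v'\<close>
    alone.\<close>
  define lx hx ly hy where "lx = fst v + min 0 (fst d)" "hx = fst v + max 0 (fst d)"
    "ly = snd v + min 0 (snd d)" "hy = snd v + max 0 (snd d)"
  note defs = this
  have c: "N * lx \<le> N * fst v" "N * lx \<le> N * fst v'" "N * fst v \<le> N * hx" "N * fst v' \<le> N * hx"
    "N * ly \<le> N * snd v" "N * ly \<le> N * snd v'" "N * snd v \<le> N * hy" "N * snd v' \<le> N * hy"
    using N_pos unfolding defs v' by auto
  have yb: "N * lx - e - w \<le> fst y" "fst y \<le> N * hx + e + w" "N * ly - e - w \<le> snd y" "snd y \<le> N * hy + e + w"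
    using box_bounds(1)[OF y, of "N * lx - e"] box_bounds(2)[OF y, of "N * hx + e"]
      box_bounds(3)[OF y, of "N * ly - e"] box_bounds(4)[OF y, of "N * hy + e"] c rob e_bounds
    unfolding fst_conv snd_conv by linarith+
  have "lx \<le> cell1 (fst x)" "cell1 (fst x) \<le> hx" "ly \<le> cell1 (snd x)" "cell1 (snd x) \<le> hy"
    by (rule cell1_ge cell1_le; use yb xy' xy(2) w_bounds e_bounds N_pos in linarith)+
  then show ?thesis using d unfolding defs v' cell_def dirs_def by (cases v) auto
qed

text \<open>Cops are counted at \<open>s0\<close>, not at the current state \<open>s\<close>, so
  that one count serves a whole detour: until \<open>s\<close> no cop has drifted by more than
  \<open>N / 8\<close>.\<close>

lemma coarse_step:
  assumes s: "reach step s0 t s" "t \<le> 300 * T" "P s" "at_cell s v"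
    and d: "d \<in> dirs" "v \<in> S" and v': "v' = (fst v + fst d, snd v + snd d)" "v' \<in> S"
    and S: "inside S" "real (cnt s0 S) \<le> \<kappa>"
  shows "\<exists>s'. reach step s0 (t + T) s' \<and> P s' \<and> at_cell s' v'"
proof -
  define q where "q = (N * fst v', N * snd v')"
  have T8: "8 * int t \<le> N" using s(2) T_bound by linarith
  have "x \<in> V" if "x \<in> box (rob s) q w" for x
    using cell_box_edge[OF s(4) d(1) v'(1) that[unfolded q_def], of 0 x] d(2) v'(2) N_pos
      inside_cell[OF S(1), of x] unfolding near_def by fastforce
  then have box_V: "box (rob s) q w \<subseteq> V" by blast
  have sub: "cell (cop s0 i) \<in> S" if "cop s i \<in> box (rob s) q w" for i
    using cell_box_edge[OF s(4) d(1) v'(1) that[unfolded q_def] reach_cop[OF s(1)] T8] d(2) v'(2)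
    by auto
  have "card {i. i < k \<and> cop s i \<in> box (rob s) q w} \<le> cnt s0 S"
    unfolding cnt_def by (rule card_mono) (use sub in auto)
  then have "real (card {i. i < k \<and> cop s i \<in> box (rob s) q w}) \<le> \<kappa>" using S(2) by linarith
  moreover have "near e (fst (rob s) + N * fst d, snd (rob s) + N * snd d) q"
    using s(4) unfolding at_cell_def near_def q_def v' by (auto simp: algebra_simps)
  ultimately obtain s' where "reach step s T s'" "P s'" "near e q (rob s')"
    using mover_reach[OF mover s(3) d(1) _ box_V] by blast
  then show ?thesis using reach_trans[OF s(1)] unfolding at_cell_def q_def by blast
qed

lemma coarse_segment:
  assumes s: "reach step s0 t s" "t + l * T \<le> 300 * T" "P s" "at_cell s v"
    and d: "d \<in> dirs" and S: "inside S" "real (cnt s0 S) \<le> \<kappa>"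
    and seg: "\<And>m. m \<le> l \<Longrightarrow> (fst v + int m * fst d, snd v + int m * snd d) \<in> S"
  shows "\<exists>s'. reach step s0 (t + l * T) s' \<and> P s' \<and>
    at_cell s' (fst v + int l * fst d, snd v + int l * snd d)"
  using s(2) seg
proof (induction l)
  case 0 then show ?case using s by (intro exI[of _ s]) auto
next
  case (Suc l)
  obtain s1 where s1: "reach step s0 (t + l * T) s1" "P s1"
      "at_cell s1 (fst v + int l * fst d, snd v + int l * snd d)"
    using Suc.IH Suc.prems(1) Suc.prems(2)[OF le_SucI] by auto
  have "t + l * T \<le> 300 * T" using Suc.prems(1) by simp
  from coarse_step[OF s1(1) this s1(2,3) d Suc.prems(2)[of l] refl _ S]
  show ?case using Suc.prems(2)[of "Suc l"] by (simp add: algebra_simps)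
qed

end

section \<open>Detours\<close>

text \<open>The threshold is real because loads start at \<open>1 / 2\<close>.\<close>

lemma pigeonhole_disjoint_card:
  fixes a :: real
  assumes "finite A" "disjoint_family_on B J" "finite J" "J \<noteq> {}" "\<And>j. j \<in> J \<Longrightarrow> B j \<subseteq> A"
    "real (card A) \<le> real (card J) * a"
  shows "\<exists>j\<in>J. real (card (B j)) \<le> a"
proof (rule ccontr)
  assume "\<not> ?thesis"
  then have "(\<Sum>j\<in>J. a) < (\<Sum>j\<in>J. real (card (B j)))"
    using assms(3,4) by (intro sum_strict_mono) auto
  also have "\<dots> = real (card (\<Union>j\<in>J. B j))"
    using assms(1,2,3,5) by (subst card_UN_disjoint')
      (auto intro: finite_subset)
  also have "\<dots> \<le> real (card A)" using assms(1,5) by (intro of_nat_mono card_mono) auto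
  finally show False using assms(6) by simp
qed

context level
begin

lemma mult_N_mono: "X \<le> Y \<Longrightarrow> N * X \<le> N * Y"
  using N_pos by simp

text \<open>Cells at distance 4 end at \<open>4.5 * N\<close>, which with the error \<open>e\<close>
  is still within \<open>5 * N\<close>. In the converse \<open>square_imp_light\<close>, error and
  drift take \<open>5 * N\<close> to less than \<open>5.5 * N\<close>, the outer edge of the cells
  at distance 5.\<close>

lemma light_imp_square:
  assumes "at_cell s v" "light k rob cop N a s" shows "real (cnt s (square v 4)) \<le> a"
proof -
  have "near (5 * N) (rob s) (cop s i)" if "cell (cop s i) \<in> square v 4" for i
  proof -
    define c where "c = cop s i"
    have "\<bar>cell1 (fst c) - fst v\<bar> \<le> 4" "\<bar>cell1 (snd c) - snd v\<bar> \<le> 4"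
      using that unfolding cell_def near_def c_def by auto
    then have "N * (fst v - 4) \<le> N * cell1 (fst c)" "N * cell1 (fst c) \<le> N * (fst v + 4)"
      "N * (snd v - 4) \<le> N * cell1 (snd c)" "N * cell1 (snd c) \<le> N * (snd v + 4)"
      by (auto intro!: mult_N_mono)
    then show ?thesis
      using assms(1) cell1_lower[of "fst c"] cell1_upper[of "fst c"] cell1_lower[of "snd c"] cell1_upper[of "snd c"] e_bounds
      unfolding at_cell_def near_def c_def[symmetric] fst_conv snd_conv abs_le_iff right_diff_distrib distrib_left
      by linarith
  qed
  then have "cnt s (square v 4) \<le> card {i. i < k \<and> near (5 * N) (rob s) (cop s i)}"
    unfolding cnt_def by (intro card_mono) auto
  then show ?thesis using assms(2) unfolding light_def by linarith
qed

lemma square_imp_light: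
  assumes "at_cell s' v" "reach step s t s'" "t \<le> 300 * T" "real (cnt s (square v 5)) \<le> a"
  shows "light k rob cop N a s'"
proof -
  have T8: "8 * int t \<le> N" using assms(3) T_bound by linarith
  have "cell (cop s i) \<in> square v 5" if "near (5 * N) (rob s') (cop s' i)" for i
  proof -
    define c where "c = cop s i"
    have "near (int t) c (cop s' i)" unfolding c_def by (rule reach_cop[OF assms(2)])
    then have b: "2 * (N * (fst v - 5)) - N \<le> 2 * fst c" "2 * fst c < 2 * (N * (fst v + 5)) + N"
      "2 * (N * (snd v - 5)) - N \<le> 2 * snd c" "2 * snd c < 2 * (N * (snd v + 5)) + N"
      using assms(1) that T8 e_bounds N_pos
      unfolding at_cell_def near_def fst_conv snd_conv abs_le_iff right_diff_distrib distrib_left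
      by linarith+
    have "fst v - 5 \<le> cell1 (fst c)" "cell1 (fst c) \<le> fst v + 5"
      "snd v - 5 \<le> cell1 (snd c)" "cell1 (snd c) \<le> snd v + 5"
      by (rule cell1_ge cell1_le; use b in linarith)+
    then show ?thesis unfolding c_def[symmetric] cell_def near_def by auto
  qed
  then have "card {i. i < k \<and> near (5 * N) (rob s') (cop s' i)} \<le> cnt s (square v 5)"
    unfolding cnt_def by (intro card_mono) auto
  then show ?thesis using assms(4) unfolding light_def by linarith
qed

text \<open>
  The four detours, \<open>j = 0, \<dots>, 3\<close>, from \<open>(X, Y)\<close> back to row \<open>y\<close> are nested: the \<open>j\<close>-th goes west by
  \<open>j\<close>, up to row \<open>y + 60 + j\<close>, east to column \<open>X + 13 + 11 j\<close> and down. The columns of arrival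
  are \<open>11\<close> apart so that the squares of radius \<open>5\<close> around the end points are disjoint.
\<close>

definition arc :: "int \<Rightarrow> int \<Rightarrow> int \<Rightarrow> int \<Rightarrow> (int \<times> int) set" where
  "arc X Y y j = {X - j..X} \<times> {Y} \<union> {X - j} \<times> {Y..y + 60 + j} \<union>
     {X - j..X + 13 + 11 * j} \<times> {y + 60 + j} \<union> {X + 13 + 11 * j} \<times> {y..y + 60 + j}"

text \<open>The square around the start is removed because all detours share it; its cops are
  bounded by lightness at departure. The square around the end point is added so that lightness
  holds on arrival.\<close>

definition detour_region :: "int \<Rightarrow> int \<Rightarrow> int \<Rightarrow> int \<Rightarrow> (int \<times> int) set" where
  "detour_region X Y y j = (arc X Y y j \<union> square (X + 13 + 11 * j, y) 5) - square (X, Y) 4"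

definition detour_zone :: "int \<Rightarrow> int \<Rightarrow> (int \<times> int) set" where
  "detour_zone X y = {X - 4..X + 51} \<times> {y - 70..y + 70}"

lemma arc_subset_zone: "\<bar>Y - y\<bar> \<le> 51 \<Longrightarrow> 0 \<le> j \<Longrightarrow> j < 4 \<Longrightarrow> arc X Y y j \<subseteq> detour_zone X y"
  unfolding arc_def detour_zone_def by auto

lemma detour_region_subset_zone:
  "\<bar>Y - y\<bar> \<le> 51 \<Longrightarrow> 0 \<le> j \<Longrightarrow> j < 4 \<Longrightarrow> detour_region X Y y j \<subseteq> detour_zone X y"
  using arc_subset_zone[of Y y j X] unfolding detour_region_def
  by (auto simp: detour_zone_def near_def)

text \<open>Two arcs meet only along their first legs in row \<open>Y\<close>, which lie in the
  removed square. The remaining legs are nested, and the arrival squares lie east of the start and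
  below the top rows, in disjoint ranges of columns.\<close>

lemma detour_regions_disjoint:
  assumes "\<bar>Y - y\<bar> \<le> 51" "0 \<le> i" "i < j" "j < 4"
  shows "detour_region X Y y i \<inter> detour_region X Y y j = {}"
proof -
  have False if "u \<in> detour_region X Y y i" "u \<in> detour_region X Y y j" for u
  proof -
    obtain a b where u: "u = (a, b)" by (cases u)
    have o: "\<not> near 4 (X, Y) (a, b)" using that u unfolding detour_region_def by auto
    have split: "(a = X - l \<and> Y \<le> b \<and> b \<le> y + 60 + l) \<or> (X - l \<le> a \<and> a \<le> X + 13 + 11 * l \<and> b = y + 60 + l) \<or>
        (a = X + 13 + 11 * l \<and> y \<le> b \<and> b \<le> y + 60 + l) \<or>
        (X + 8 + 11 * l \<le> a \<and> a \<le> X + 18 + 11 * l \<and> b \<le> y + 5)"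
      if "u \<in> detour_region X Y y l" "0 \<le> l" "l < 4" for l
      using that o u unfolding detour_region_def arc_def near_def by auto
    show False using split[of i] split[of j] that assms by linarith
  qed
  then show ?thesis by blast
qed

lemma inside_mono: "inside S \<Longrightarrow> S' \<subseteq> S \<Longrightarrow> inside S'"
  unfolding inside_def by blast

lemma follow_arc:
  assumes s: "P s" "at_cell s (X, Y)" and Y: "\<bar>Y - y\<bar> \<le> 51" and j: "0 \<le> j" "j < 4"
    and S: "inside (arc X Y y j)" "real (cnt s (arc X Y y j)) \<le> \<kappa>"
  shows "\<exists>s'. reach step s (300 * T) s' \<and> P s' \<and> at_cell s' (X + 13 + 11 * j, y)"
proof -
  let ?S = "arc X Y y j"
  \<comment> \<open>The lengths of the legs west, up, east and down; they add up to at most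
    229.\<close>
  define a b c d where "a = nat j" "b = nat (y + 60 + j - Y)" "c = nat (13 + 12 * j)" "d = nat (60 + j)"
  note defs = this
  have ints: "int a = j" "int b = y + 60 + j - Y" "int c = 13 + 12 * j" "int d = 60 + j"
    using Y j unfolding defs by auto
  have "a + b + c + d \<le> 300" using ints Y j by linarith
  then have le: "(a + b + c + d) * T \<le> 300 * T" by (rule mult_le_mono1)
  have le': "a * T + b * T + c * T + d * T \<le> 300 * T" using le by (simp add: distrib_right)
  obtain s1 where s1: "reach step s (0 + a * T) s1" "P s1" "at_cell s1 (X - j, Y)"
    using coarse_segment[of s 0 s a "(X, Y)" "(-1, 0)" ?S] s S le' ints j reach_refl[of step s 0]
    unfolding arc_def by (auto simp: dirs_def)
  obtain s2 where s2: "reach step s (a * T + b * T) s2" "P s2" "at_cell s2 (X - j, y + 60 + j)"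
    using coarse_segment[of s "a * T" s1 b "(X - j, Y)" "(0, 1)" ?S] s1 S le' ints j Y
    unfolding arc_def by (auto simp: dirs_def)
  obtain s3 where s3: "reach step s (a * T + b * T + c * T) s3" "P s3" "at_cell s3 (X + 13 + 11 * j, y + 60 + j)"
    using coarse_segment[of s "a * T + b * T" s2 c "(X - j, y + 60 + j)" "(1, 0)" ?S] s2 S le' ints j Y
    unfolding arc_def by (auto simp: dirs_def algebra_simps)
  obtain s4 where s4: "reach step s (a * T + b * T + c * T + d * T) s4" "P s4" "at_cell s4 (X + 13 + 11 * j, y)"
    using coarse_segment[of s "a * T + b * T + c * T" s3 d "(X + 13 + 11 * j, y + 60 + j)" "(0, -1)" ?S] s3 S le' ints j Y
    unfolding arc_def by (auto simp: dirs_def algebra_simps)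
  show ?thesis using s4 reach_mono[OF s4(1) le'] by blast
qed

text \<open>One of four disjoint regions holds at most a quarter of the \<open>2 * \<kappa>\<close>
  cops. The removed square contributes at most \<open>\<kappa> / 2\<close> more, so the arc meets
  the bound \<kappa> of the smaller scale.\<close>

lemma detour:
  assumes s: "P s" "at_cell s (X, Y)" "light k rob cop N (\<kappa> / 2) s" and Y: "\<bar>Y - y\<bar> \<le> 51"
    and Z: "inside (detour_zone X y)" "real (cnt s (detour_zone X y)) \<le> 2 * \<kappa>"
  shows "\<exists>s' X'. reach step s (300 * T) s' \<and> P s' \<and> light k rob cop N (\<kappa> / 2) s' \<and>
    at_cell s' (X', y) \<and> X + 13 \<le> X' \<and> X' \<le> X + 46"
proof -
  define B where "B j = {i. i < k \<and> cell (cop s i) \<in> detour_region X Y y j}" for j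
  have "disjoint_family_on B {0..<4}"
    unfolding disjoint_family_on_def
  proof (intro ballI impI)
    fix i j :: int assume ij: "i \<in> {0..<4}" "j \<in> {0..<4}" "i \<noteq> j"
    have "detour_region X Y y i \<inter> detour_region X Y y j = {}"
      using detour_regions_disjoint[OF Y, of i j X] detour_regions_disjoint[OF Y, of j i X] ij
      by (cases "i < j") auto
    then show "B i \<inter> B j = {}" unfolding B_def by blast
  qed
  moreover have "B j \<subseteq> {i. i < k \<and> cell (cop s i) \<in> detour_zone X y}" if "j \<in> {0..<4}" for j
    using detour_region_subset_zone[OF Y, of j X] that unfolding B_def by auto
  ultimately have "\<exists>j\<in>{0..<4::int}. real (card (B j)) \<le> \<kappa> / 2"
    using Z(2) unfolding cnt_def
    by (intro pigeonhole_disjoint_card[of "{i. i < k \<and> cell (cop s i) \<in> detour_zone X y}"]) auto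
  then obtain j where j: "0 \<le> j" "j < 4" "real (cnt s (detour_region X Y y j)) \<le> \<kappa> / 2"
    unfolding B_def cnt_def by auto
  have sq: "real (cnt s (square (X, Y) 4)) \<le> \<kappa> / 2" by (rule light_imp_square[OF s(2,3)])
  have "cnt s (arc X Y y j) \<le> cnt s (detour_region X Y y j \<union> square (X, Y) 4)"
    by (rule cnt_mono) (auto simp: detour_region_def)
  also have "\<dots> \<le> cnt s (detour_region X Y y j) + cnt s (square (X, Y) 4)" by (rule cnt_Un)
  finally have "real (cnt s (arc X Y y j)) \<le> \<kappa>" using j(3) sq by linarith
  with follow_arc[OF s(1,2) Y j(1,2)] inside_mono[OF Z(1) arc_subset_zone[OF Y j(1,2)]]
  obtain s' where s': "reach step s (300 * T) s'" "P s'" "at_cell s' (X + 13 + 11 * j, y)" by blast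
  \<comment> \<open>The arrival column is at least 13 away from \<open>X\<close>, and
    \<open>5 + 4 = 9\<close>: the arrival square misses the removed one.\<close>
  have "square (X + 13 + 11 * j, y) 5 \<subseteq> detour_region X Y y j"
    if "\<not> near 9 (X, Y) (X + 13 + 11 * j, y)"
    using that unfolding detour_region_def near_def by auto
  then have "cnt s (square (X + 13 + 11 * j, y) 5) \<le> cnt s (detour_region X Y y j)"
    using j(1) by (intro cnt_mono) (auto simp: near_def)
  then have "light k rob cop N (\<kappa> / 2) s'"
    using j(3) by (intro square_imp_light[OF s'(3,1)]) auto
  with s' j(1,2) show ?thesis by (intro exI[of _ s'] exI[of _ "X + 13 + 11 * j"]) auto
qed

end

section \<open>One run at the next scale\<close>

text \<open>The induction step in normal position: start at the origin, direction east. The target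
  may be off by \<open>50 * N\<close>, the error of runs at the new scale. The margin consists of
  \<open>200 * N\<close> for detours and the distance a cop can cover during the run.\<close>

locale journey = level +
  fixes s0 :: 'a and L :: nat and D1 D2 :: int
  assumes start: "P s0" "rob s0 = (0, 0)" "light k rob cop N (\<kappa> / 2) s0"
    and L: "50 \<le> L" and D1: "\<bar>D1 - int L * N\<bar> \<le> 50 * N" and D2: "\<bar>D2\<bar> \<le> 50 * N"
    and box_V: "box (0, 0) (D1, D2) (200 * N + int ((L + 2000) * T)) \<subseteq> V"
    and box_cops: "real (card {i. i < k \<and>
      cop s0 i \<in> box (0, 0) (D1, D2) (200 * N + int ((L + 2000) * T))}) \<le> 2 * \<kappa>"
begin

definition goal_col :: int where "goal_col = D1 div N"
definition goal_row :: int where "goal_row = cell1 D2"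
text \<open>Large enough for every detour from a column in \<open>0..goal_col\<close>: the rows of
  \<open>detour_zone\<close> reach 70 beyond \<open>goal_row\<close>, itself at most 50, and its
  columns reach 51 further east.\<close>

definition zone :: "(int \<times> int) set" where "zone = {-4..goal_col + 100} \<times> {-150..150}"
text \<open>A fixed set of cops for the whole run: any other cop starts too far away to enter
  \<open>zone\<close> in time.\<close>

definition Q :: "nat set" where
  "Q = {i. i < k \<and> cop s0 i \<in> box (0, 0) (D1, D2) (200 * N + int ((L + 2000) * T))}"
text \<open>The cops that the robber, in column \<open>X\<close>, still has to reckon with.\<close>

definition ahead :: "int \<Rightarrow> 'a \<Rightarrow> nat set" where
  "ahead X s = {i \<in> Q. N * (X - 5) \<le> fst (cop s i)}"

lemma goal_col_bounds: "N * goal_col \<le> D1" "D1 < N * goal_col + N"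
proof -
  have "D1 = N * goal_col + D1 mod N" unfolding goal_col_def by simp
  then show "N * goal_col \<le> D1" "D1 < N * goal_col + N"
    using pos_mod_bound[OF N_pos, of D1] pos_mod_sign[OF N_pos, of D1] by linarith+
qed

lemma goal_col_range: "0 \<le> goal_col" "goal_col \<le> int L + 50"
proof -
  have "N * 50 \<le> N * int L" using L by (intro mult_N_mono) simp
  then have "0 \<le> D1" using D1 by (simp add: mult.commute)
  then show "0 \<le> goal_col" unfolding goal_col_def using N_pos by (simp add: pos_imp_zdiv_nonneg_iff)
  have "D1 < (int L + 51) * N" using D1 N_pos by (simp add: algebra_simps)
  then have "goal_col < int L + 51"
    using goal_col_bounds(1) N_pos by (metis mult.commute mult_less_cancel_left_pos order_le_less_trans)
  then show "goal_col \<le> int L + 50" by simp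
qed

lemma goal_row_range: "\<bar>goal_row\<bar> \<le> 50"
proof -
  have "-50 \<le> goal_row" "goal_row \<le> 50" unfolding goal_row_def
    by (rule cell1_ge cell1_le; use D2 N_pos in linarith)+
  then show ?thesis by simp
qed

lemma finite_Q: "finite Q" unfolding Q_def by simp

lemma card_Q: "real (card Q) \<le> 2 * \<kappa>" using box_cops unfolding Q_def .

lemma near_zone_in_box:
  assumes "cell c \<in> zone" "near (int t) x c" "t \<le> (L + 2000) * T"
  shows "x \<in> box (0, 0) (D1, D2) (200 * N + int ((L + 2000) * T))"
proof -
  have t: "int t \<le> int ((L + 2000) * T)" using assms(3) by (simp only: of_nat_le_iff)
  have "N * (-4) \<le> N * cell1 (fst c)" "N * cell1 (fst c) \<le> N * (goal_col + 100)"
    "N * (-150) \<le> N * cell1 (snd c)" "N * cell1 (snd c) \<le> N * 150"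
    by (rule mult_N_mono; use assms(1) in \<open>auto simp: zone_def cell_def\<close>)+
  then have "N * (-5) \<le> fst c" "fst c \<le> D1 + 101 * N" "N * (-151) \<le> snd c" "snd c \<le> 151 * N"
    using cell1_lower[of "fst c"] cell1_upper[of "fst c"] cell1_lower[of "snd c"]
      cell1_upper[of "snd c"] goal_col_bounds N_pos unfolding distrib_left by linarith+
  then have "- (200 * N + int ((L + 2000) * T)) \<le> fst x" "fst x \<le> D1 + (200 * N + int ((L + 2000) * T))"
    "- (200 * N + int ((L + 2000) * T)) \<le> snd x" "snd x \<le> 200 * N + int ((L + 2000) * T)"
    using assms(2) t N_pos unfolding near_def abs_le_iff by linarith+
  then show ?thesis unfolding box_def mem_Times_iff atLeastAtMost_iff fst_conv snd_conv
    by linarith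
qed

lemma inside_zone: "inside zone"
  unfolding inside_def
proof (intro ballI allI impI)
  fix v x assume v: "v \<in> zone" and x: "near N (N * fst v, N * snd v) x"
  have "N * (-4) \<le> N * fst v" "N * fst v \<le> N * (goal_col + 100)"
    "N * (-150) \<le> N * snd v" "N * snd v \<le> N * 150"
    by (rule mult_N_mono; use v in \<open>auto simp: zone_def\<close>)+
  moreover have "0 \<le> int ((L + 2000) * T)" by simp
  ultimately have "- (200 * N + int ((L + 2000) * T)) \<le> fst x" "fst x \<le> D1 + (200 * N + int ((L + 2000) * T))"
    "- (200 * N + int ((L + 2000) * T)) \<le> snd x" "snd x \<le> 200 * N + int ((L + 2000) * T)"
    using x goal_col_bounds N_pos unfolding near_def abs_le_iff fst_conv snd_conv distrib_left by linarith+
  then have "x \<in> box (0, 0) (D1, D2) (200 * N + int ((L + 2000) * T))"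
    unfolding box_def mem_Times_iff atLeastAtMost_iff fst_conv snd_conv by linarith
  then show "x \<in> V" using box_V by blast
qed

lemma zone_cop_in_Q:
  assumes "reach step s0 t s" "t \<le> (L + 2000) * T" "i < k" "cell (cop s i) \<in> zone"
  shows "i \<in> Q"
  using near_zone_in_box[OF assms(4) reach_cop[OF assms(1)] assms(2)] assms(3) unfolding Q_def by simp

lemma cnt_zone:
  assumes "reach step s0 t s" "t \<le> (L + 2000) * T" "S \<subseteq> zone"
  shows "real (cnt s S) \<le> 2 * \<kappa>"
proof -
  have "cnt s S \<le> card Q" unfolding cnt_def
    by (rule card_mono[OF finite_Q]) (use zone_cop_in_Q[OF assms(1,2)] assms(3) in auto)
  then show ?thesis using card_Q by linarith
qed

text \<open>The threshold moves east by at least one column while a cop gains at most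
  \<open>N / 8\<close>, so no cop left behind comes back into account.\<close>

lemma ahead_antimono:
  assumes "reach step s t s'" "8 * int t \<le> N" "X + 1 \<le> X'" shows "ahead X' s' \<subseteq> ahead X s"
proof
  fix i assume "i \<in> ahead X' s'"
  then have i: "i \<in> Q" "N * (X' - 5) \<le> fst (cop s' i)" unfolding ahead_def by auto
  have "N * (X - 4) \<le> N * (X' - 5)" using assms(3) by (intro mult_N_mono) simp
  then have "N * (X - 5) \<le> fst (cop s i)"
    using i(2) reach_cop[OF assms(1), of i] assms(2) N_pos
    unfolding near_def abs_le_iff right_diff_distrib by linarith
  then show "i \<in> ahead X s" using i(1) unfolding ahead_def by simp
qed

text \<open>The crowding cops are west of \<open>N * (X + 7)\<close>. The drift is less than one
  column and \<open>X' - 5\<close> is at least \<open>X + 8\<close>, so all of them leave the set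
  \<open>ahead\<close>.\<close>

lemma ahead_drop:
  assumes s: "reach step s t s'" "8 * int t \<le> N" "X + 13 \<le> X'" and s0: "reach step s0 t0 s" "t0 \<le> (L + 2000) * T"
    and S: "square (X + 1, y) 5 \<subseteq> zone" "a < real (cnt s (square (X + 1, y) 5))"
  shows "real (card (ahead X' s')) \<le> real (card (ahead X s)) - a"
proof -
  define B where "B = {i. i < k \<and> cell (cop s i) \<in> square (X + 1, y) 5}"
  have i: "i \<in> ahead X s \<and> i \<notin> ahead X' s'" if "i \<in> B" for i
  proof -
    define c where "c = cop s i"
    have "i \<in> Q" using zone_cop_in_Q[OF s0] S(1) that unfolding B_def by auto
    have "\<bar>cell1 (fst c) - (X + 1)\<bar> \<le> 5" using that unfolding B_def near_def cell_def c_def by simp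
    then have "N * (X - 4) \<le> N * cell1 (fst c)" "N * cell1 (fst c) \<le> N * (X + 6)"
      by (auto intro!: mult_N_mono)
    then have c: "N * (X - 5) \<le> fst c" "fst c < N * (X + 7)"
      using cell1_lower[of "fst c"] cell1_upper[of "fst c"] N_pos
      unfolding right_diff_distrib distrib_left by linarith+
    have "N * (X + 8) \<le> N * (X' - 5)" using s(3) by (intro mult_N_mono) simp
    then have "fst (cop s' i) < N * (X' - 5)"
      using c(2) reach_cop[OF s(1), of i] s(2) N_pos
      unfolding near_def abs_le_iff right_diff_distrib distrib_left c_def by linarith
    then show ?thesis using c(1) \<open>i \<in> Q\<close> unfolding ahead_def c_def by simp
  qed
  have fin: "finite (ahead X s)" using finite_Q unfolding ahead_def by simp
  have "ahead X' s' \<subseteq> ahead X s - B"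
    using ahead_antimono[OF s(1,2), of X X'] s(3) i by auto
  then have "card (ahead X' s') \<le> card (ahead X s - B)" using fin by (intro card_mono) auto
  also have "\<dots> = card (ahead X s) - card B" using i fin
    by (intro card_Diff_subset) (auto simp: B_def)
  finally have "card (ahead X' s') \<le> card (ahead X s) - card B" .
  moreover have "card B \<le> card (ahead X s)" using i fin by (intro card_mono) auto
  ultimately have "card (ahead X' s') + card B \<le> card (ahead X s)" by linarith
  then show ?thesis using S(2) unfolding cnt_def B_def[symmetric] by linarith
qed

text \<open>The last hypothesis is a potential that never rises: a straight step costs
  \<open>T\<close> and saves a column, a detour costs \<open>300 * T\<close> and removes at least
  \<open>\<kappa> / 2\<close> cops from \<open>ahead\<close>. The induction is on the columns left;
  46 is the largest eastward gain of a detour and bounds the overshoot.\<close>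

lemma advance:
  assumes "reach step s0 t s" "P s" "light k rob cop N (\<kappa> / 2) s" "at_cell s (X, goal_row)"
    "0 \<le> X" "X \<le> goal_col + 46"
    "real t + real T * (real (nat (goal_col - X)) + 300 * (real (card (ahead X s)) / (\<kappa> / 2)))
       \<le> real ((L + 2000) * T)"
  shows "\<exists>s' X'. reach step s0 ((L + 2000) * T) s' \<and> P s' \<and> light k rob cop N (\<kappa> / 2) s' \<and>
    at_cell s' (X', goal_row) \<and> goal_col \<le> X' \<and> X' \<le> goal_col + 46"
  using assms
proof (induction "nat (goal_col - X)" arbitrary: X s t rule: less_induct)
  case less
  note s = less.prems
  have nonneg: "0 \<le> real T * (real (nat (goal_col - X)) + 300 * (real (card (ahead X s)) / (\<kappa> / 2)))"
    using \<kappa>_pos by auto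
  then have t: "t \<le> (L + 2000) * T" using s(7) by linarith
  show ?case
  proof (cases "goal_col \<le> X")
    case True
    then show ?thesis using s reach_mono[OF s(1) t] by blast
  next
    case X: False
    have sq: "square (X + 1, goal_row) 5 \<subseteq> zone"
      using X s(5) goal_row_range unfolding zone_def near_def by auto
    have T8: "8 * int T \<le> N" "8 * int (300 * T) \<le> N" using T_bound by linarith+
    show ?thesis
    proof (cases "real (cnt s (square (X + 1, goal_row) 5)) \<le> \<kappa> / 2")
      case True
      have "\<exists>s'. reach step s (0 + T) s' \<and> P s' \<and> at_cell s' (X + 1, goal_row)"
        using s(2,4) True \<kappa>_pos inside_mono[OF inside_zone sq]
        by (intro coarse_step[where d = "(1, 0)" and v = "(X, goal_row)" and S = "square (X + 1, goal_row) 5"])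
           (auto simp: reach_refl dirs_def near_def)
      then obtain s' where s': "reach step s T s'" "P s'" "at_cell s' (X + 1, goal_row)" by auto
      have light: "light k rob cop N (\<kappa> / 2) s'"
        by (rule square_imp_light[OF s'(3,1) _ True]) simp
      have "ahead (X + 1) s' \<subseteq> ahead X s" by (rule ahead_antimono[OF s'(1) T8(1)]) simp
      then have "card (ahead (X + 1) s') \<le> card (ahead X s)"
        using finite_Q by (intro card_mono) (auto simp: ahead_def)
      then have c: "real (card (ahead (X + 1) s')) / (\<kappa> / 2) \<le> real (card (ahead X s)) / (\<kappa> / 2)"
        using \<kappa>_pos by (intro divide_right_mono) auto
      have n: "real (nat (goal_col - (X + 1))) = real (nat (goal_col - X)) - 1" using X by simp
      have "real T * (real (nat (goal_col - (X + 1))) + 300 * (real (card (ahead (X + 1) s')) / (\<kappa> / 2)))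
        \<le> real T * (real (nat (goal_col - X)) + 300 * (real (card (ahead X s)) / (\<kappa> / 2)) - 1)"
        unfolding n using c by (intro mult_left_mono) auto
      then have budget: "real (t + T) + real T * (real (nat (goal_col - (X + 1))) +
          300 * (real (card (ahead (X + 1) s')) / (\<kappa> / 2))) \<le> real ((L + 2000) * T)"
        using s(7) by (simp add: algebra_simps)
      show ?thesis
        by (rule less.hyps[OF _ reach_trans[OF s(1) s'(1)] s'(2) light s'(3) _ _ budget])
           (use X s(5) in auto)
    next
      case False
      have dz: "detour_zone X goal_row \<subseteq> zone"
        using X s(5) goal_row_range unfolding zone_def detour_zone_def by auto
      obtain s' X' where s': "reach step s (300 * T) s'" "P s'" "light k rob cop N (\<kappa> / 2) s'"
          "at_cell s' (X', goal_row)" "X + 13 \<le> X'" "X' \<le> X + 46"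
        using detour[OF s(2,4,3) _ inside_mono[OF inside_zone dz] cnt_zone[OF s(1) t dz]] by auto
      have "real (card (ahead X' s')) \<le> real (card (ahead X s)) - \<kappa> / 2"
        by (rule ahead_drop[OF s'(1) T8(2) s'(5) s(1) t sq]) (use False in simp)
      then have "real (card (ahead X' s')) / (\<kappa> / 2) \<le> (real (card (ahead X s)) - \<kappa> / 2) / (\<kappa> / 2)"
        using \<kappa>_pos by (intro divide_right_mono) auto
      then have c: "real (card (ahead X' s')) / (\<kappa> / 2) \<le> real (card (ahead X s)) / (\<kappa> / 2) - 1"
        using \<kappa>_pos by (simp add: diff_divide_distrib)
      have n: "real (nat (goal_col - X')) \<le> real (nat (goal_col - X))" using s'(5) by simp
      have "real T * (real (nat (goal_col - X')) + 300 * (real (card (ahead X' s')) / (\<kappa> / 2)))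
        \<le> real T * (real (nat (goal_col - X)) + 300 * (real (card (ahead X s)) / (\<kappa> / 2)) - 300)"
        using c n by (intro mult_left_mono) auto
      then have budget: "real (t + 300 * T) + real T * (real (nat (goal_col - X')) +
          300 * (real (card (ahead X' s')) / (\<kappa> / 2))) \<le> real ((L + 2000) * T)"
        using s(7) by (simp add: algebra_simps)
      show ?thesis
        by (rule less.hyps[OF _ reach_trans[OF s(1) s'(1)] s'(2,3,4) _ _ budget])
           (use X s(5) s'(5,6) in auto)
    qed
  qed
qed

text \<open>An initial detour changes from row 0 to \<open>goal_row\<close>. The at most
  \<open>2 * \<kappa>\<close> cops ahead then allow four more, so
  \<open>300 + (L + 50) + 4 * 300\<close> multiples of \<open>T\<close> suffice. Overshoot, rounding
  and \<open>e\<close> together stay below \<open>50 * N\<close>.\<close>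

lemma arrival:
  "\<exists>s'. reach step s0 ((L + 2000) * T) s' \<and> P s' \<and> light k rob cop N (\<kappa> / 2) s' \<and>
    near (50 * N) (D1, D2) (rob s')"
proof -
  have dz: "detour_zone 0 goal_row \<subseteq> zone"
    using goal_col_range goal_row_range unfolding zone_def detour_zone_def by auto
  have start_cell: "at_cell s0 (0, 0)"
    using start(2) e_bounds unfolding at_cell_def near_def by simp
  have row: "\<bar>0 - goal_row\<bar> \<le> 51" using goal_row_range by simp
  obtain s X where s: "reach step s0 (300 * T) s" "P s" "light k rob cop N (\<kappa> / 2) s"
      "at_cell s (X, goal_row)" "13 \<le> X" "X \<le> 46"
    using detour[OF start(1) start_cell start(3) row inside_mono[OF inside_zone dz]
        cnt_zone[OF reach_refl[of _ _ 0] _ dz]] by auto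
  have "card (ahead X s) \<le> card Q" using finite_Q by (intro card_mono) (auto simp: ahead_def)
  then have "real (card (ahead X s)) \<le> 2 * \<kappa>" using card_Q by linarith
  then have "real (card (ahead X s)) / (\<kappa> / 2) \<le> 4" using \<kappa>_pos by (simp add: field_simps)
  moreover have "real (nat (goal_col - X)) \<le> real L + 50" using goal_col_range s(5) by linarith
  ultimately have "real T * (real (nat (goal_col - X)) + 300 * (real (card (ahead X s)) / (\<kappa> / 2)))
      \<le> real T * (real L + 1700)"
    by (intro mult_left_mono) auto
  then have "real (300 * T) + real T * (real (nat (goal_col - X)) + 300 * (real (card (ahead X s)) / (\<kappa> / 2)))
       \<le> real ((L + 2000) * T)"
    by (simp add: algebra_simps)
  from advance[OF s(1,2,3,4) _ _ this] obtain s' X' where s': "reach step s0 ((L + 2000) * T) s'" "P s'"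
      "light k rob cop N (\<kappa> / 2) s'" "at_cell s' (X', goal_row)" "goal_col \<le> X'" "X' \<le> goal_col + 46"
    using s(5,6) goal_col_range by auto
  have "N * goal_col \<le> N * X'" "N * X' \<le> N * (goal_col + 46)"
    using s'(5,6) by (auto intro!: mult_N_mono)
  then have "near (50 * N) (D1, D2) (rob s')"
    using s'(4) goal_col_bounds e_bounds N_pos cell1_lower[of D2] cell1_upper[of D2]
    unfolding at_cell_def near_def goal_row_def fst_conv snd_conv abs_le_iff distrib_left by linarith
  then show ?thesis using s' by blast
qed

end

text \<open>Coordinates in which the robber starts at the origin and runs east.\<close>

definition to_frame :: "int \<times> int \<Rightarrow> int \<times> int \<Rightarrow> int \<times> int \<Rightarrow> int \<times> int" where
  "to_frame p d x =
     (fst d * (fst x - fst p) + snd d * (snd x - snd p), fst d * (snd x - snd p) - snd d * (fst x - fst p))"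

text \<open>In complex notation, \<open>to_frame\<close> multiplies \<open>x - p\<close> by the
  conjugate of the unit \<open>d\<close>, and \<open>from_frame\<close> is its inverse,
  \<open>p + d * x\<close>.\<close>

definition from_frame :: "int \<times> int \<Rightarrow> int \<times> int \<Rightarrow> int \<times> int \<Rightarrow> int \<times> int" where
  "from_frame p d x =
     (fst p + fst d * fst x - snd d * snd x, snd p + fst d * snd x + snd d * fst x)"

lemma to_from_frame: "d \<in> dirs \<Longrightarrow> to_frame p d (from_frame p d x) = x"
  and from_to_frame: "d \<in> dirs \<Longrightarrow> from_frame p d (to_frame p d x) = x"
  unfolding to_frame_def from_frame_def dirs_def by (auto simp: prod_eq_iff)

section \<open>Invariance of corridors and runs under translations and right-angle rotations\<close>

lemma near_frame: "d \<in> dirs \<Longrightarrow> near r (to_frame p d x) (to_frame p d y) \<longleftrightarrow> near r x y"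
  unfolding to_frame_def near_def dirs_def by auto

text \<open>Membership in one side of a box without \<open>min\<close> and \<open>max\<close>, so
  that reflections, which exchange the two, are handled by propositional reasoning.\<close>

definition between :: "int \<Rightarrow> int \<Rightarrow> int \<Rightarrow> int \<Rightarrow> bool" where
  "between w u v x \<longleftrightarrow> (u - w \<le> x \<or> v - w \<le> x) \<and> (x \<le> u + w \<or> x \<le> v + w)"

lemma between_shift: "between w (u - p) (v - p) (x - p) \<longleftrightarrow> between w u v x"
  and between_reflect: "between w (p - u) (p - v) (p - x) \<longleftrightarrow> between w u v x"
  unfolding between_def by auto

lemma box_iff_between:
  "x \<in> box a b w \<longleftrightarrow> between w (fst a) (fst b) (fst x) \<and> between w (snd a) (snd b) (snd x)"
  unfolding box_def between_def by (auto simp: mem_Times_iff)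

lemma box_frame:
  assumes "d \<in> dirs"
  shows "to_frame p d x \<in> box (to_frame p d a) (to_frame p d b) w \<longleftrightarrow> x \<in> box a b w"
proof -
  consider "d = (1, 0)" | "d = (-1, 0)" | "d = (0, 1)" | "d = (0, -1)"
    using assms unfolding dirs_def by auto
  then show ?thesis
    by cases (simp_all add: box_iff_between to_frame_def between_shift between_reflect conj_commute)
qed

lemma shift_in_frame:
  "d \<in> dirs \<Longrightarrow> to_frame p d (fst p + M * fst d, snd p + M * snd d) = (M, 0)"
  unfolding dirs_def to_frame_def by auto

lemma shift_frame:
  assumes "d \<in> dirs" "\<delta> \<in> dirs"
  obtains \<delta>' where "\<delta>' \<in> dirs"
    "to_frame p d (fst x + N * fst \<delta>', snd x + N * snd \<delta>') =
      (fst (to_frame p d x) + N * fst \<delta>, snd (to_frame p d x) + N * snd \<delta>)"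
proof
  show "from_frame (0, 0) d \<delta> \<in> dirs" using assms unfolding dirs_def from_frame_def by auto
  show "to_frame p d (fst x + N * fst (from_frame (0, 0) d \<delta>), snd x + N * snd (from_frame (0, 0) d \<delta>)) =
      (fst (to_frame p d x) + N * fst \<delta>, snd (to_frame p d x) + N * snd \<delta>)"
    using assms unfolding dirs_def from_frame_def to_frame_def by (auto simp: algebra_simps)
qed

lemma mover_frame:
  fixes p :: "int \<times> int"
  assumes m: "mover step k rob cop V P N T e w \<kappa>" and d: "d \<in> dirs"
  defines "F \<equiv> to_frame p d"
  shows "mover step k (\<lambda>s. F (rob s)) (\<lambda>s i. F (cop s i)) (F ` V) P N T e w \<kappa>"
  unfolding mover_def
proof (intro allI impI)
  fix s \<delta> q
  assume s: "P s" "\<delta> \<in> dirs" "near e (fst (F (rob s)) + N * fst \<delta>, snd (F (rob s)) + N * snd \<delta>) q"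
    "box (F (rob s)) q w \<subseteq> F ` V" "real (card {i. i < k \<and> F (cop s i) \<in> box (F (rob s)) q w}) \<le> \<kappa>"
  obtain \<delta>' where \<delta>': "\<delta>' \<in> dirs" "F (fst (rob s) + N * fst \<delta>', snd (rob s) + N * snd \<delta>') =
      (fst (F (rob s)) + N * fst \<delta>, snd (F (rob s)) + N * snd \<delta>)"
    using shift_frame[OF d s(2)] unfolding F_def by metis
  obtain q' where q: "q = F q'" using to_from_frame[OF d] unfolding F_def by metis
  have box: "F x \<in> box (F (rob s)) q w \<longleftrightarrow> x \<in> box (rob s) q' w" for x
    unfolding q F_def by (rule box_frame[OF d])
  have inj: "inj F" using from_to_frame[OF d] unfolding F_def by (metis injI)
  have "box (rob s) q' w \<subseteq> V"
    using s(4) box inj by (metis image_subset_iff inj_image_mem_iff subset_iff)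
  moreover have "near e (fst (rob s) + N * fst \<delta>', snd (rob s) + N * snd \<delta>') q'"
    using s(3) unfolding \<delta>'(2)[symmetric] q unfolding F_def near_frame[OF d] .
  ultimately obtain s' t where "t \<le> T" "(step ^^ t) s s'" "P s'" "near e q' (rob s')"
    using m s(1,5) \<delta>'(1) unfolding mover_def box by blast
  then show "\<exists>s' t. t \<le> T \<and> (step ^^ t) s s' \<and> P s' \<and> near e q (F (rob s'))"
    unfolding q F_def near_frame[OF d] by blast
qed

text \<open>The induction on scales: a \<open>journey\<close> in the frame of the robber at the
  start of the run. Lightness at spacing \<open>N\<close> joins the invariant because detours need
  it at departure.\<close>

theorem mover_raise:
  assumes lev: "level step k rob cop V P N T e w \<kappa>" and L: "50 \<le> L"
  shows "mover step k rob cop V (\<lambda>s. P s \<and> light k rob cop N (\<kappa> / 2) s) (int L * N) ((L + 2000) * T)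
    (50 * N) (200 * N + int ((L + 2000) * T)) (2 * \<kappa>)"
  unfolding mover_def
proof (intro allI impI)
  let ?w = "200 * N + int ((L + 2000) * T)"
  fix s d q
  assume s: "P s \<and> light k rob cop N (\<kappa> / 2) s" and d: "d \<in> dirs"
    and q: "near (50 * N) (fst (rob s) + int L * N * fst d, snd (rob s) + int L * N * snd d) q"
    and box: "box (rob s) q ?w \<subseteq> V" "real (card {i. i < k \<and> cop s i \<in> box (rob s) q ?w}) \<le> 2 * \<kappa>"
  define F where "F = to_frame (rob s) d"
  have F0: "F (rob s) = (0, 0)" unfolding F_def to_frame_def by simp
  have light: "light k (\<lambda>s. F (rob s)) (\<lambda>s i. F (cop s i)) M a = light k rob cop M a" for M a
    unfolding light_def F_def near_frame[OF d] ..
  have eq: "F x \<in> box (0, 0) (fst (F q), snd (F q)) ?w \<longleftrightarrow> x \<in> box (rob s) q ?w" for x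
    unfolding F0[symmetric] unfolding F_def prod.collapse by (rule box_frame[OF d])
  have "box (0, 0) (fst (F q), snd (F q)) ?w \<subseteq> F ` V"
  proof
    fix y assume y: "y \<in> box (0, 0) (fst (F q), snd (F q)) ?w"
    have F: "F (from_frame (rob s) d y) = y" unfolding F_def using to_from_frame[OF d] by simp
    then have "from_frame (rob s) d y \<in> V"
      using y eq[of "from_frame (rob s) d y"] box(1) by auto
    then show "y \<in> F ` V" using F by (rule rev_image_eqI[OF _ sym])
  qed
  moreover have "\<bar>fst (F q) - int L * N\<bar> \<le> 50 * N" "\<bar>snd (F q)\<bar> \<le> 50 * N"
    using near_frame[OF d, THEN iffD2, OF q, of "rob s"] shift_in_frame[OF d, of "rob s" "int L * N"]
    unfolding F_def by (auto simp: near_def)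
  moreover have "level step k (\<lambda>s. F (rob s)) (\<lambda>s i. F (cop s i)) (F ` V) P N T e w \<kappa>"
    using lev mover_frame[OF level.mover[OF lev] d, of "rob s"]
    unfolding level_def F_def near_frame[OF d] by blast
  ultimately have "journey step k (\<lambda>s. F (rob s)) (\<lambda>s i. F (cop s i)) (F ` V) P N T e w \<kappa>
    s L (fst (F q)) (snd (F q))"
    using s L box(2) F0 by (intro journey.intro journey_axioms.intro) (auto simp only: light eq)
  from journey.arrival[OF this]
  obtain s' where s': "reach step s ((L + 2000) * T) s'" "P s'" "light k rob cop N (\<kappa> / 2) s'"
      "near (50 * N) (F q) (F (rob s'))"
    unfolding light prod.collapse by blast
  then show "\<exists>s' t. t \<le> (L + 2000) * T \<and> (step ^^ t) s s' \<and>
      (P s' \<and> light k rob cop N (\<kappa> / 2) s') \<and> near (50 * N) q (rob s')"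
    unfolding reach_def F_def near_frame[OF d] by blast
qed

section \<open>All scales\<close>

text \<open>
  The parameters of \<open>mover\<close> at scale \<open>j\<close>, out of \<open>m\<close> scales. Since \<open>load 0 < 1\<close>, the corridors at
  scale \<open>0\<close> are free of cops, and there the robber runs \<open>7200\<close> steps in one turn.
\<close>

definition side :: "nat \<Rightarrow> nat \<Rightarrow> int" where "side m j = 7200 * (2000 * int m) ^ j"
definition time :: "nat \<Rightarrow> nat \<Rightarrow> nat" where "time m j = (2000 * m + 2000) ^ j"
definition err :: "nat \<Rightarrow> nat \<Rightarrow> int" where
  "err m j = (case j of 0 \<Rightarrow> 0 | Suc i \<Rightarrow> 50 * side m i)"
text \<open>At scale 0 the margin 1 is the reach of the cops' reply.\<close>

definition margin :: "nat \<Rightarrow> nat \<Rightarrow> int" where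
  "margin m j = (case j of 0 \<Rightarrow> 1 | Suc i \<Rightarrow> 200 * side m i + int (time m j))"
definition load :: "nat \<Rightarrow> real" where "load j = 2 ^ j / 2"

lemma load_Suc: "load (Suc j) = 2 * load j" and load_pos: "0 < load j"
  unfolding load_def by simp_all

lemma side_Suc: "side m (Suc j) = 2000 * int m * side m j"
  unfolding side_def by simp

lemma side_ge: "1 \<le> m \<Longrightarrow> 7200 \<le> side m j"
  unfolding side_def using one_le_power[of "2000 * int m" j] by linarith

lemma side_Suc_ge: "1 \<le> m \<Longrightarrow> 2000 * side m j \<le> side m (Suc j)"
  unfolding side_Suc using side_ge[of m j] by (intro mult_right_mono) auto

text \<open>The loss per scale is \<open>1 + 1 / m\<close>, since \<open>L = 2000 * m\<close>; over
  at most \<open>m\<close> scales it accumulates to at most 3, which \<open>7200 = 3 * 2400\<close>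
  pays for.\<close>

lemma time_bound:
  assumes "1 \<le> m" "j \<le> m" shows "2400 * int (time m j) \<le> side m j"
proof -
  have "(1 + 1 / real m) ^ j \<le> exp (1 / real m) ^ j"
    by (intro power_mono exp_ge_add_one_self) auto
  also have "\<dots> = exp (real j / real m)" by (simp add: exp_of_nat_mult[symmetric])
  also have "\<dots> \<le> exp 1" using assms by (simp add: divide_le_eq)
  also have "\<dots> \<le> 3" by (rule exp_le)
  finally have *: "(1 + 1 / real m) ^ j \<le> 3" .
  have "real (time m j) = (2000 * real m * (1 + 1 / real m)) ^ j"
    using assms(1) unfolding time_def by (simp add: distrib_left)
  also have "\<dots> = (2000 * real m) ^ j * (1 + 1 / real m) ^ j" by (rule power_mult_distrib)
  also have "\<dots> \<le> (2000 * real m) ^ j * 3" by (rule mult_left_mono[OF *]) simp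
  finally have "real_of_int (2400 * int (time m j)) \<le> real_of_int (side m j)"
    unfolding side_def by (simp add: mult.commute power_mult_distrib)
  then show ?thesis by (simp only: of_int_le_iff)
qed

lemma err_bounds:
  assumes m: "1 \<le> m" shows "0 \<le> err m j" "8 * err m j \<le> side m j"
proof -
  have "0 \<le> err m j \<and> 8 * err m j \<le> side m j"
    by (cases j; use side_ge[OF m, of "j - 1"] side_Suc_ge[OF m, of "j - 1"] side_ge[OF m, of 0] in
      \<open>simp add: err_def\<close>)
  then show "0 \<le> err m j" "8 * err m j \<le> side m j" by auto
qed

lemma margin_bounds:
  assumes m: "1 \<le> m" "j \<le> m" shows "0 \<le> margin m j" "8 * margin m j \<le> side m j"
proof -
  have "0 \<le> margin m j \<and> 8 * margin m j \<le> side m j"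
    by (cases j; use side_ge[OF m(1), of "j - 1"] side_Suc_ge[OF m(1), of "j - 1"] side_ge[OF m(1), of 0]
      time_bound[OF m] in \<open>simp add: margin_def\<close>)
  then show "0 \<le> margin m j" "8 * margin m j \<le> side m j" by auto
qed

text \<open>The invariant of runs at scale \<open>j\<close>: lightness at every smaller
  scale.\<close>

primrec safe :: "nat \<Rightarrow> ('s \<Rightarrow> int \<times> int) \<Rightarrow> ('s \<Rightarrow> nat \<Rightarrow> int \<times> int) \<Rightarrow> ('s \<Rightarrow> bool) \<Rightarrow> nat \<Rightarrow> nat \<Rightarrow> 's \<Rightarrow> bool" where
  "safe k rob cop P m 0 = P"
| "safe k rob cop P m (Suc j) = (\<lambda>s. safe k rob cop P m j s \<and> light k rob cop (side m j) (load j / 2) s)"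

lemma level_all:
  assumes slow: "\<And>s s' i. step s s' \<Longrightarrow> near 1 (cop s i) (cop s' i)"
    and base: "mover step k rob cop V P 7200 1 0 1 (1 / 2)" and m: "1 \<le> m"
  shows "j \<le> m \<Longrightarrow> level step k rob cop V (safe k rob cop P m j) (side m j) (time m j) (err m j) (margin m j) (load j)"
proof (induction j)
  case 0
  show ?case
    using slow base m unfolding level_def by (simp add: side_def time_def err_def margin_def load_def)
next
  case (Suc j)
  have "mover step k rob cop V (safe k rob cop P m (Suc j)) (int (2000 * m) * side m j)
      ((2000 * m + 2000) * time m j) (50 * side m j)
      (200 * side m j + int ((2000 * m + 2000) * time m j)) (2 * load j)"
    using mover_raise[of step k rob cop V _ _ _ _ _ _ "2000 * m"] Suc m by simp
  then have "mover step k rob cop V (safe k rob cop P m (Suc j)) (side m (Suc j)) (time m (Suc j))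
      (err m (Suc j)) (margin m (Suc j)) (load (Suc j))"
    by (simp add: side_Suc err_def margin_def load_Suc time_def)
  then show ?case
    using slow m Suc.prems side_ge[OF m, of "Suc j"] err_bounds[OF m, of "Suc j"] margin_bounds[OF m, of "Suc j"]
      time_bound[OF m, of "Suc j"] load_pos[of "Suc j"]
    unfolding level_def by auto
qed

lemma card_index_eq_0: "card {i. i < k \<and> Q i} = 0 \<longleftrightarrow> (\<forall>i<k. \<not> Q i)" for k :: nat
proof -
  have "finite {i. i < k \<and> Q i}" by (rule finite_subset[of _ "{..<k}"]) auto
  then show ?thesis by auto
qed

text \<open>Descent through the scales: four candidates are \<open>13 * side m j\<close> apart, so
  their squares of radius \<open>6 * side m j\<close> are disjoint and one holds at most a quarter
  of the cops; the search continues around it. The extra 1 in the radii allows for the cops' first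
  move after the robber's placement.\<close>

lemma exists_safe_point:
  fixes k :: nat
  assumes m: "1 \<le> m"
  shows "real (card {i. i < k \<and> near (side m j) z (c i)}) \<le> load j \<Longrightarrow>
    \<exists>x. near (err m j) z x \<and> (\<forall>i<k. \<not> near 1 x (c i)) \<and>
      (\<forall>l<j. real (card {i. i < k \<and> near (5 * side m l + 1) x (c i)}) \<le> load l / 2)"
proof (induction j arbitrary: z)
  case 0
  have "card {i. i < k \<and> near (side m 0) z (c i)} = 0"
    using 0 unfolding load_def power_0 by linarith
  then have "\<not> near (side m 0) z (c i)" if "i < k" for i using that unfolding card_index_eq_0 by blast
  then have "\<not> near 1 z (c i)" if "i < k" for i
    using near_mono[of 1 z "c i" "side m 0"] side_ge[OF m, of 0] that by auto
  then show ?case using err_bounds[OF m, of 0] by (intro exI[of _ z]) (auto simp: near_def)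
next
  case (Suc j)
  let ?N = "side m j"
  have N: "7200 \<le> ?N" "2000 * ?N \<le> side m (Suc j)" using side_ge[OF m] side_Suc_ge[OF m] by auto
  define y where "y l = (fst z + 13 * (int l * ?N), snd z)" for l :: nat
  define B where "B l = {i. i < k \<and> near (6 * ?N) (y l) (c i)}" for l
  have far: "13 * ?N \<le> \<bar>fst (y l) - fst (y l')\<bar>" if "l \<noteq> l'" for l l'
  proof -
    have "fst (y l) - fst (y l') = 13 * ?N * (int l - int l')" unfolding y_def by (simp add: algebra_simps)
    moreover have "1 \<le> \<bar>int l - int l'\<bar>" using that by linarith
    ultimately show ?thesis using N(1) mult_left_mono[of 1 "\<bar>int l - int l'\<bar>" "13 * ?N"] by (simp add: abs_mult)
  qed
  have disj: "disjoint_family_on B {..<4}"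
    unfolding disjoint_family_on_def
  proof (intro ballI impI)
    fix l l' :: nat assume "l \<noteq> l'"
    from far[OF this] show "B l \<inter> B l' = {}" using N(1) unfolding B_def near_def by auto
  qed
  have y: "near (39 * ?N) z (y l)" if "l \<in> {..<4}" for l
  proof -
    have "int l * ?N \<le> 3 * ?N" using that N(1) by (intro mult_right_mono) auto
    then show ?thesis using N(1) unfolding y_def near_def by (simp add: abs_mult)
  qed
  have "B l \<subseteq> {i. i < k \<and> near (side m (Suc j)) z (c i)}" if "l \<in> {..<4}" for l
  proof
    fix i assume "i \<in> B l"
    then have "i < k" "near (39 * ?N + 6 * ?N) z (c i)"
      using near_trans[OF y[OF that]] unfolding B_def by blast+
    then show "i \<in> {i. i < k \<and> near (side m (Suc j)) z (c i)}"
      using N by (auto elim!: near_mono)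
  qed
  with disj have "\<exists>l\<in>{..<4::nat}. real (card (B l)) \<le> load j / 2"
    using Suc.prems
    by (intro pigeonhole_disjoint_card[of "{i. i < k \<and> near (side m (Suc j)) z (c i)}"]) (auto simp: load_Suc lessThan_empty_iff)
  then obtain l where l: "l \<in> {..<4}" "real (card (B l)) \<le> load j / 2" by blast
  have "card {i. i < k \<and> near ?N (y l) (c i)} \<le> card (B l)"
    unfolding B_def by (intro card_mono) (use N(1) in \<open>auto elim!: near_mono\<close>)
  then have "real (card {i. i < k \<and> near ?N (y l) (c i)}) \<le> load j" using l(2) load_pos[of j] by linarith
  from Suc.IH[OF this] obtain x where x: "near (err m j) (y l) x" "\<forall>i<k. \<not> near 1 x (c i)"
      "\<forall>l<j. real (card {i. i < k \<and> near (5 * side m l + 1) x (c i)}) \<le> load l / 2" by blast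
  have e: "8 * err m j \<le> ?N" by (rule err_bounds[OF m])
  have "near (6 * ?N) (y l) (c i)" if "near (5 * ?N + 1) x (c i)" for i
    using near_mono[OF near_trans[OF x(1) that], of "6 * ?N"] e N(1) by linarith
  then have "card {i. i < k \<and> near (5 * ?N + 1) x (c i)} \<le> card (B l)"
    unfolding B_def by (intro card_mono) auto
  then have "real (card {i. i < k \<and> near (5 * ?N + 1) x (c i)}) \<le> load j / 2" using l(2) by linarith
  moreover have "near (err m (Suc j)) z x"
    using near_mono[OF near_trans[OF y[OF l(1)] x(1)], of "err m (Suc j)"] e N(1) by (simp add: err_def)
  ultimately show ?case using x(2,3) unfolding less_Suc_eq by blast
qed

section \<open>The game on the grid\<close>

text \<open>Passing between members of \<open>A\<close> may take several steps, so single steps are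
  chosen within the set of states from which \<open>A\<close> is reachable.\<close>

lemma infinite_chain:
  assumes "x \<in> A" "\<And>x. x \<in> A \<Longrightarrow> \<exists>y\<in>A. S\<^sup>+\<^sup>+ x y"
  obtains f where "f 0 = x" "\<And>n. S (f n) (f (Suc n))"
proof -
  define B where "B = {x. \<exists>y\<in>A. S\<^sup>*\<^sup>* x y}"
  have "\<exists>y. y \<in> B \<and> S x y" if xB: "x \<in> B" for x
  proof -
    obtain y where "y \<in> A" "S\<^sup>*\<^sup>* x y" using xB unfolding B_def by blast
    moreover obtain z where "z \<in> A" "S\<^sup>+\<^sup>+ y z" using assms(2) calculation(1) by blast
    ultimately have "S\<^sup>+\<^sup>+ x z" by simp
    then obtain x' where "S x x'" "S\<^sup>*\<^sup>* x' z" by (meson tranclpD)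
    then show ?thesis using \<open>z \<in> A\<close> unfolding B_def by blast
  qed
  moreover have "x \<in> B" using assms(1) unfolding B_def by blast
  ultimately have "\<exists>f. \<forall>n. (f n \<in> B \<and> (n = 0 \<longrightarrow> f n = x)) \<and> S (f n) (f (Suc n))"
    by (intro dependent_nat_choice) auto
  then show ?thesis using that by blast
qed

lemma vwalk_map_upt:
  assumes "\<And>i. i \<le> l \<Longrightarrow> p i \<in> verts G" "\<And>i. i < l \<Longrightarrow> (p i, p (Suc i)) \<in> arcs_ends G"
  shows "vwalk (map p [0..<Suc l]) G"
  using assms
proof (induction l arbitrary: p)
  case 0 then show ?case by (auto simp: vwalk_def)
next
  case (Suc l)
  have eq: "map p [0..<Suc (Suc l)] = p 0 # map (\<lambda>i. p (Suc i)) [0..<Suc l]"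
    by (simp only: upt_conv_Cons[of 0 "Suc (Suc l)"] map_Suc_upt[symmetric] list.map map_map o_def zero_less_Suc simp_thms if_True)
  have "hd (map (\<lambda>i. p (Suc i)) [0..<Suc l]) = p 1"
    by (simp add: upt_conv_Cons del: upt_Suc)
  then show ?case unfolding eq using Suc.prems
    by (intro vwalk_consI Suc.IH) auto
qed

section \<open>The game as a transition system on histories of the robber\<close>

definition ipos :: "nat \<times> nat \<Rightarrow> int \<times> int" where "ipos v = (int (fst v), int (snd v))"

text \<open>A state is the history \<open>h\<close>, which determines the cops:
  \<open>\<sigma> h\<close> is their position when the robber is to move, and
  \<open>\<sigma> h'\<close> already contains their reply.\<close>

definition gstep :: "nat \<Rightarrow> nat \<Rightarrow> ((nat \<times> nat) list \<Rightarrow> (nat \<times> nat) list) \<Rightarrow> (nat \<times> nat) list \<Rightarrow> (nat \<times> nat) list \<Rightarrow> bool" where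
  "gstep n R \<sigma> h h' \<longleftrightarrow> h \<noteq> [] \<and>
     (\<exists>v. h' = h @ [v] \<and> robber_move (grid n) R (\<sigma> h) (last h) v \<and> v \<notin> set (\<sigma> h'))"

lemma cop_strategy_length:
  assumes "cop_strategy G k \<sigma>" shows "length (\<sigma> h) = k"
proof (induction h rule: rev_induct)
  case Nil then show ?case using assms by (simp add: cop_strategy_def)
next
  case (snoc v h)
  have "cops_move G (\<sigma> h) (\<sigma> (h @ [v]))"
    using assms unfolding cop_strategy_def by blast
  then show ?case using snoc unfolding cops_move_def by (auto dest: list_all2_lengthD)
qed

lemma cop_strategy_near:
  assumes "cop_strategy (grid n) k \<sigma>" "i < k"
  shows "near 1 (ipos (\<sigma> h ! i)) (ipos (\<sigma> (h @ [v]) ! i))"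
proof -
  have "list_all2 (\<lambda>u v. v = u \<or> u \<rightarrow>\<^bsub>grid n\<^esub> v) (\<sigma> h) (\<sigma> (h @ [v]))"
    using assms(1) unfolding cop_strategy_def cops_move_def by blast
  from list_all2_nthD[OF this, of i] show ?thesis
    using assms(2) cop_strategy_length[OF assms(1)] by (auto simp: near_def ipos_def grid_def)
qed

definition rob_at :: "(nat \<times> nat) list \<Rightarrow> int \<times> int" where "rob_at h = ipos (last h)"

text \<open>Indices from \<open>k\<close> on stand still at a dummy point, so that the speed bound
  of \<open>level\<close> holds for all indices.\<close>

definition cop_at :: "((nat \<times> nat) list \<Rightarrow> (nat \<times> nat) list) \<Rightarrow> nat \<Rightarrow> (nat \<times> nat) list \<Rightarrow> nat \<Rightarrow> int \<times> int" where
  "cop_at \<sigma> k h i = (if i < k then ipos (\<sigma> h ! i) else (0, 0))"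

definition board :: "nat \<Rightarrow> (int \<times> int) set" where
  "board n = {0..<int n} \<times> {0..<int n}"

lemma gstep_cop_near:
  assumes "cop_strategy (grid n) k \<sigma>" "gstep n R \<sigma> h h'"
  shows "near 1 (cop_at \<sigma> k h i) (cop_at \<sigma> k h' i)"
  using cop_strategy_near[OF assms(1)] assms(2) unfolding gstep_def cop_at_def by (auto simp: near_def)

lemma cop_at_iff:
  assumes "cop_strategy (grid n) k \<sigma>"
  shows "v \<in> set (\<sigma> h) \<longleftrightarrow> (\<exists>i<k. cop_at \<sigma> k h i = ipos v)"
  unfolding in_set_conv_nth cop_strategy_length[OF assms] cop_at_def ipos_def
  by (auto simp: prod_eq_iff)

text \<open>At most \<open>1 / 2\<close> cops means none, so the straight walk is legal; by the
  margin 1 no cop can capture the robber at \<open>q\<close> in reply.\<close>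

lemma base_mover:
  assumes \<sigma>: "cop_strategy (grid n) k \<sigma>"
  shows "mover (gstep n R \<sigma>) k rob_at (cop_at \<sigma> k) (board n) (\<lambda>h. h \<noteq> []) (int R) 1 0 1 (1 / 2)"
  unfolding mover_def
proof (intro allI impI)
  fix h :: "(nat \<times> nat) list" and d q
  assume h: "h \<noteq> []" and d: "d \<in> dirs"
    and "near 0 (fst (rob_at h) + int R * fst d, snd (rob_at h) + int R * snd d) q"
    and V: "box (rob_at h) q 1 \<subseteq> board n"
    and "real (card {i. i < k \<and> cop_at \<sigma> k h i \<in> box (rob_at h) q 1}) \<le> 1 / 2"
  then have q: "q = (fst (rob_at h) + int R * fst d, snd (rob_at h) + int R * snd d)"
    and c: "real (card {i. i < k \<and> cop_at \<sigma> k h i \<in> box (rob_at h) q 1}) \<le> 1 / 2"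
    by (auto simp: near_def prod_eq_iff)
  from c have "card {i. i < k \<and> cop_at \<sigma> k h i \<in> box (rob_at h) q 1} = 0" by linarith
  then have free: "cop_at \<sigma> k h i \<notin> box (rob_at h) q 1" if "i < k" for i
    using that unfolding card_index_eq_0 by blast
  define z where "z i = (fst (rob_at h) + int i * fst d, snd (rob_at h) + int i * snd d)" for i
  define p where "p i = (nat (fst (z i)), nat (snd (z i)))" for i
  have z_box: "z i \<in> box (rob_at h) q 1" if "i \<le> R" for i
    using d that unfolding z_def q box_def dirs_def by auto
  have z_q: "z R = q" unfolding z_def q by simp
  have z_V: "0 \<le> fst (z i)" "fst (z i) < int n" "0 \<le> snd (z i)" "snd (z i) < int n" if "i \<le> R" for i
    using z_box[OF that] V unfolding board_def by auto
  have p: "ipos (p i) = z i" if "i \<le> R" for i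
    using z_V[OF that] unfolding ipos_def p_def by simp
  have p0: "p 0 = last h" unfolding p_def z_def rob_at_def ipos_def by simp
  have verts: "p i \<in> verts (grid n)" if "i \<le> R" for i
    using z_V[OF that] unfolding p_def grid_def by auto
  have arcs: "(p i, p (Suc i)) \<in> arcs_ends (grid n)" if "i < R" for i
  proof -
    have le: "i \<le> R" "Suc i \<le> R" using that by auto
    obtain a b a' b' where ab: "p i = (a, b)" "p (Suc i) = (a', b')" by (meson surj_pair)
    have "int a = fst (z i)" "int b = snd (z i)" "int a' = fst (z i) + fst d" "int b' = snd (z i) + snd d"
      using p[OF le(1)] p[OF le(2)] unfolding ab ipos_def z_def by (simp_all add: distrib_right)
    then have "int a' = int a + fst d" "int b' = int b + snd d" by simp_all
    then have "a' = a \<and> (b' = Suc b \<or> b = Suc b') \<or> b' = b \<and> (a' = Suc a \<or> a = Suc a')"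
      using d unfolding dirs_def by auto
    then show ?thesis using verts[OF le(1)] verts[OF le(2)] unfolding ab by (auto simp: grid_def)
  qed
  define w where "w = map p [0..<Suc R]"
  have walk: "vwalk w (grid n)" unfolding w_def by (rule vwalk_map_upt) (use verts arcs in auto)
  have w_ends: "hd w = last h" "last w = p R" "vwalk_length w \<le> R"
    unfolding w_def p0[symmetric] by (simp_all add: hd_map hd_upt del: upt_Suc) simp
  have avoid: "v \<notin> set (\<sigma> h)" if "ipos v \<in> box (rob_at h) q 1" for v
    using that free unfolding cop_at_iff[OF \<sigma>] by metis
  have "set w \<inter> set (\<sigma> h) = {}"
  proof -
    have "p i \<notin> set (\<sigma> h)" if "i \<le> R" for i using avoid[of "p i"] p[OF that] z_box[OF that] by simp
    then show ?thesis unfolding w_def by auto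
  qed
  with walk w_ends have move: "robber_move (grid n) R (\<sigma> h) (last h) (p R)"
    unfolding robber_move_def by blast
  let ?h = "h @ [p R]"
  have "p R \<notin> set (\<sigma> ?h)"
  proof
    assume "p R \<in> set (\<sigma> ?h)"
    then obtain i where i: "i < k" "cop_at \<sigma> k ?h i = q"
      using p[of R] z_q unfolding cop_at_iff[OF \<sigma>] by auto
    have "near 1 (cop_at \<sigma> k h i) q"
      using cop_strategy_near[OF \<sigma> i(1), of h "p R"] i unfolding cop_at_def by simp
    then have "cop_at \<sigma> k h i \<in> box (rob_at h) q 1" unfolding near_def box_def by (auto simp: mem_Times_iff)
    then show False using free[OF i(1)] by simp
  qed
  then have "gstep n R \<sigma> h ?h" using h move unfolding gstep_def by blast
  moreover have "rob_at ?h = q" using p[of R] z_q unfolding rob_at_def by simp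
  ultimately show "\<exists>s' t. t \<le> 1 \<and> (gstep n R \<sigma> ^^ t) h s' \<and> s' \<noteq> [] \<and> near 0 q (rob_at s')"
    by (intro exI[of _ ?h] exI[of _ 1]) (auto simp: near_def)
qed

text \<open>The histories of the chain are the prefixes of one play. The cops' replies miss the
  robber by \<open>gstep\<close>, and his walks avoid the cops, including at their last
  vertex.\<close>

lemma robber_escapes:
  assumes chain: "\<And>t. gstep n R \<sigma> (hs t) (hs (Suc t))" "hs 0 = [v0]"
    and v0: "v0 \<in> verts (grid n)" "v0 \<notin> set (\<sigma> [])" "v0 \<notin> set (\<sigma> [v0])"
  shows "\<exists>r. robber_play (grid n) R \<sigma> r \<and> (\<forall>t. \<not> caught \<sigma> r t)"
proof -
  define r where "r t = last (hs t)" for t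
  have hs: "hs t = map r [0..<Suc t]" for t
  proof (induction t)
    case 0 then show ?case using chain(2) by (simp add: r_def)
  next
    case (Suc t)
    obtain v where "hs (Suc t) = hs t @ [v]" using chain(1)[of t] unfolding gstep_def by blast
    moreover from this have "v = r (Suc t)" by (simp add: r_def)
    ultimately show ?case using Suc by simp
  qed
  have step: "robber_move (grid n) R (cops_at \<sigma> r (Suc t)) (r t) (r (Suc t)) \<and>
      r (Suc t) \<notin> set (cops_at \<sigma> r (Suc (Suc t)))" for t
  proof -
    obtain v where v: "hs (Suc t) = hs t @ [v]" "robber_move (grid n) R (\<sigma> (hs t)) (last (hs t)) v"
      "v \<notin> set (\<sigma> (hs (Suc t)))"
      using chain(1)[of t] unfolding gstep_def by blast
    have "v = r (Suc t)" using v(1) by (simp add: r_def)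
    then show ?thesis using v(2,3) unfolding cops_at_def hs[symmetric] r_def[of t] by simp
  qed
  have r0: "r 0 = v0" using chain(2) by (simp add: r_def)
  have "r (Suc t) \<notin> set (cops_at \<sigma> r (Suc t))" for t
    using step[of t] unfolding robber_move_def vwalk_def by (metis disjoint_iff last_in_set)
  then have "\<not> caught \<sigma> r t" for t
    using step v0(2,3) r0 unfolding caught_def by (cases t) (auto simp: cops_at_def)
  moreover have "robber_play (grid n) R \<sigma> r"
    using step r0 v0(1) unfolding robber_play_def by simp
  ultimately show ?thesis by blast
qed

text \<open>The robber shuttles forever between \<open>(N, N)\<close> and \<open>(2 * N, N)\<close>
  with \<open>N = side m m\<close>. All cops together are at most \<open>load m\<close>, so every
  corridor qualifies.\<close>

lemma not_cops_win:
  assumes m: "1 \<le> m" and n: "4 * side m m \<le> int n" and k: "real k \<le> load m"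
  shows "\<not> cops_win (grid n) 7200 k"
proof
  assume "cops_win (grid n) 7200 k"
  then obtain \<sigma> where \<sigma>: "cop_strategy (grid n) k \<sigma>"
    and win: "\<And>r. robber_play (grid n) 7200 \<sigma> r \<Longrightarrow> \<exists>t. caught \<sigma> r t"
    unfolding cops_win_def by blast
  let ?N = "side m m"
  have N: "7200 \<le> ?N" by (rule side_ge[OF m])
  have e: "0 \<le> err m m" "8 * err m m \<le> ?N" by (rule err_bounds[OF m])+
  have w: "0 \<le> margin m m" "8 * margin m m \<le> ?N" by (rule margin_bounds[OF m]; simp)+
  let ?safe = "safe k rob_at (cop_at \<sigma> k) (\<lambda>h. h \<noteq> []) m"
  have lev: "level (gstep n 7200 \<sigma>) k rob_at (cop_at \<sigma> k) (board n) (?safe m) ?N (time m m)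
      (err m m) (margin m m) (load m)"
    by (rule level_all[OF gstep_cop_near[OF \<sigma>] base_mover[OF \<sigma>, of 7200, unfolded of_nat_numeral] m]) auto
  have card_le: "real (card {i. i < k \<and> Pr i}) \<le> load m" for Pr
  proof -
    have "card {i. i < k \<and> Pr i} \<le> card {..<k}" by (intro card_mono) auto
    then show ?thesis using k by simp
  qed
  define pq where "pq b = (if b then (?N, ?N) else (2 * ?N, ?N))" for b
  define A where "A = {h. ?safe m h \<and> (\<exists>b. near (err m m) (pq b) (rob_at h))}"
  have next_A: "\<exists>h'\<in>A. (gstep n 7200 \<sigma>)\<^sup>+\<^sup>+ h h'" if hA: "h \<in> A" for h
  proof -
    obtain b where h: "?safe m h" "near (err m m) (pq b) (rob_at h)" using hA unfolding A_def by blast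
    define d :: "int \<times> int" where "d = (if b then (1, 0) else (-1, 0))"
    have "d \<in> dirs" unfolding d_def dirs_def by simp
    moreover have "near (err m m) (fst (rob_at h) + ?N * fst d, snd (rob_at h) + ?N * snd d) (pq (\<not> b))"
      using h(2) unfolding near_def pq_def d_def by (cases b) auto
    moreover have "box (rob_at h) (pq (\<not> b)) (margin m m) \<subseteq> board n"
    proof
      fix x assume "x \<in> box (rob_at h) (pq (\<not> b)) (margin m m)"
      moreover have "0 \<le> fst (rob_at h) - margin m m" "fst (rob_at h) + margin m m < int n"
        "0 \<le> snd (rob_at h) - margin m m" "snd (rob_at h) + margin m m < int n"
        "0 \<le> fst (pq (\<not> b)) - margin m m" "fst (pq (\<not> b)) + margin m m < int n"
        "0 \<le> snd (pq (\<not> b)) - margin m m" "snd (pq (\<not> b)) + margin m m < int n"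
        using h(2) n e w N unfolding near_def pq_def by (cases b; simp; linarith)+
      ultimately show "x \<in> board n"
        unfolding box_iff_between between_def board_def mem_Times_iff atLeastLessThan_iff by linarith
    qed
    ultimately obtain h' where h': "reach (gstep n 7200 \<sigma>) h (time m m) h'" "?safe m h'"
        "near (err m m) (pq (\<not> b)) (rob_at h')"
      using mover_reach[OF level.mover[OF lev] h(1) _ _ _ card_le] by blast
    \<comment> \<open>The two ends are \<open>N\<close> apart and the errors at most
      \<open>N / 8\<close>, so the run has at least one step.\<close>
    have "h \<noteq> h'" using h(2) h'(3) e N unfolding near_def pq_def by (cases b) auto
    moreover have "(gstep n 7200 \<sigma>)\<^sup>*\<^sup>* h h'" using h'(1) unfolding reach_def by (meson relpowp_imp_rtranclp)
    ultimately have "(gstep n 7200 \<sigma>)\<^sup>+\<^sup>+ h h'" by (meson rtranclpD)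
    moreover have "h' \<in> A" using h'(2,3) unfolding A_def by blast
    ultimately show ?thesis by blast
  qed
  \<comment> \<open>Chosen against the initial placement \<open>\<sigma> []\<close>; the move to
    \<open>\<sigma> [v0]\<close> uses up the extra 1.\<close>
  obtain x where x: "near (err m m) (?N, ?N) x" "\<forall>i<k. \<not> near 1 x (cop_at \<sigma> k [] i)"
    "\<forall>l<m. real (card {i. i < k \<and> near (5 * side m l + 1) x (cop_at \<sigma> k [] i)}) \<le> load l / 2"
    using exists_safe_point[OF m card_le] by blast
  define v0 where "v0 = (nat (fst x), nat (snd x))"
  have xb: "0 \<le> fst x" "fst x < int n" "0 \<le> snd x" "snd x < int n"
    using x(1) e n N unfolding near_def by auto
  then have v0: "ipos v0 = x" "v0 \<in> verts (grid n)" unfolding v0_def ipos_def grid_def by auto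
  have near0: "near 1 (cop_at \<sigma> k [] i) (cop_at \<sigma> k [v0] i)" for i
    using cop_strategy_near[OF \<sigma>, of i "[]" v0] unfolding cop_at_def by (auto simp: near_def)
  have free: "v0 \<notin> set (\<sigma> [])" "v0 \<notin> set (\<sigma> [v0])"
    unfolding cop_at_iff[OF \<sigma>] v0(1)
    using x(2) near0 near_sym[of 1 x] near_mono[of 0 x x 1] by (force simp: near_def, metis)
  have "?safe l [v0]" if "l \<le> m" for l
    using that
  proof (induction l)
    case (Suc l)
    have "near (5 * side m l + 1) x (cop_at \<sigma> k [] i)" if "near (5 * side m l) x (cop_at \<sigma> k [v0] i)" for i
      using near_trans[OF that near_sym[THEN iffD1, OF near0]] .
    then have "card {i. i < k \<and> near (5 * side m l) x (cop_at \<sigma> k [v0] i)} \<le>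
        card {i. i < k \<and> near (5 * side m l + 1) x (cop_at \<sigma> k [] i)}"
      by (intro card_mono) auto
    moreover have "real (card {i. i < k \<and> near (5 * side m l + 1) x (cop_at \<sigma> k [] i)}) \<le> load l / 2"
      using x(3) Suc.prems by simp
    ultimately have "light k rob_at (cop_at \<sigma> k) (side m l) (load l / 2) [v0]"
      unfolding light_def rob_at_def by (simp add: v0(1))
    then show ?case using Suc by simp
  qed simp
  then have "[v0] \<in> A" using x(1) v0(1) unfolding A_def pq_def rob_at_def by auto
  then obtain hs where "hs 0 = [v0]" "\<And>t. gstep n 7200 \<sigma> (hs t) (hs (Suc t))"
    using infinite_chain[of "[v0]" A "gstep n 7200 \<sigma>"] next_A by blast
  then show False using robber_escapes[of n 7200 \<sigma> hs v0] v0(2) free win by blast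
qed

section \<open>From the number of scales to the size of the board\<close>

lemma cop_number_gt:
  assumes "1 \<le> m" "4 * side m m \<le> int n" shows "load m < real (cop_number 7200 (grid n))"
proof -
  have fin: "finite (verts (grid n))" by (simp add: grid_def)
  have "cops_win (grid n) 7200 (cop_number 7200 (grid n))"
    unfolding cop_number_def by (rule LeastI[where P = "cops_win (grid n) 7200", OF cops_win_card_verts[OF fin]])
  then show ?thesis using not_cops_win[OF assms] by force
qed

theorem theorem1:
  shows "\<exists>(R::nat) (c::real). c > 0 \<and>
    (\<forall>\<^sub>F n in sequentially.
       real (cop_number R (grid n)) \<ge> exp (c * ln (real n) / ln (ln (real n))))"
proof (intro exI conjI)
  show "(0::real) < 1 / 10" by simp
  have E: "\<forall>\<^sub>F n :: nat in sequentially. 1 < ln (real n) \<and> 3 \<le> ln (ln (real n)) \<and> ln 2000 \<le> ln (ln (real n)) / 4 \<and>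
      ln 28800 \<le> ln (real n) / 4 \<and> 100 \<le> ln (real n) / ln (ln (real n)) "
    by (intro eventually_conj; real_asymp)
  show "\<forall>\<^sub>F n in sequentially.
       real (cop_number 7200 (grid n)) \<ge> exp (1 / 10 * ln (real n) / ln (ln (real n)))"
    using E
  proof eventually_elim
    case (elim n)
    define x where "x = ln (real n) / ln (ln (real n))"
    \<comment> \<open>Half of \<open>x\<close> keeps \<open>m * ln m\<close> below half of
      \<open>ln n\<close>, which leaves room for \<open>2000 ^ m\<close> and for
      \<open>28800 = 4 * 7200\<close>.\<close>
    define m where "m = nat \<lfloor>x / 2\<rfloor>"
    have x: "100 \<le> x" using elim unfolding x_def by simp
    have mx: "real m \<le> x / 2" "x / 2 - 1 < real m" using x unfolding m_def by linarith+
    have m1: "1 \<le> m" using mx x by linarith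
    have l: "0 < ln (ln (real n))" "0 < ln (real n)" using elim by auto
    have n0: "0 < real n" using l(2) by (cases "n = 0") auto
    have xl: "x * ln (ln (real n)) = ln (real n)" using l(1) unfolding x_def by simp
    have "real m \<le> ln (real n)"
    proof -
      have "x / 2 \<le> ln (real n)" using mult_left_mono[of "1 / 2" "ln (ln (real n))" x] xl elim x by simp
      then show ?thesis using mx(1) by linarith
    qed
    then have lnm: "ln (real m) \<le> ln (ln (real n))" using m1 l(2) by simp
    have "ln (28800 * (2000 * real m) ^ m) = ln 28800 + real m * (ln 2000 + ln (real m))"
      using m1 by (simp add: ln_mult ln_realpow distrib_left)
    also have "\<dots> \<le> ln (real n) / 4 + (x / 2) * (ln (ln (real n)) / 4 + ln (ln (real n)))"
    proof (intro add_mono mult_mono)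
      show "0 \<le> ln 2000 + ln (real m)" using m1 by (intro add_nonneg_nonneg) auto
    qed (use elim lnm mx(1) x in auto)
    also have "\<dots> = ln (real n) / 4 + 5 / 8 * ln (real n)"
      using xl by (simp add: distrib_left)
    also have "\<dots> \<le> ln (real n)" using l(2) by simp
    finally have "28800 * (2000 * real m) ^ m \<le> real n"
      using m1 n0 by (subst (asm) ln_le_cancel_iff) auto
    then have "real_of_int (4 * side m m) \<le> real_of_int (int n)" unfolding side_def by simp
    then have "4 * side m m \<le> int n" by (simp only: of_int_le_iff)
    then have gt: "load m < real (cop_number 7200 (grid n))" by (rule cop_number_gt[OF m1])
    \<comment> \<open>Since \<open>ln 2\<close> is at least \<open>1 / 2\<close>, the right side is
      at least \<open>x / 4 - 1\<close>, which exceeds \<open>x / 10\<close> for \<open>x\<close> at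
      least 100.\<close>
    have "1 / 10 * x \<le> (real m - 1) * ln 2"
    proof -
      have "exp (1 / 2) \<le> (2 :: real)" by (rule exp_half_le2)
      then have ln_2_ge_half: "1 / 2 \<le> ln (2 :: real)" by (subst ln_ge_iff) auto
      have "(x / 2 - 2) * (1 / 2) \<le> (real m - 1) * ln 2"
        using mx x ln_2_ge_half by (intro mult_mono) auto
      then show ?thesis using x by simp
    qed
    then have "exp (1 / 10 * x) \<le> exp ((real m - 1) * ln 2)" by simp
    also have "\<dots> = load m" unfolding load_def
      by (simp add: left_diff_distrib exp_diff exp_of_nat_mult)
    finally show ?case using gt unfolding x_def by simp
  qed
qed

end
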